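(* Let $|\psi(\theta)\rangle_{AB}=\cos\theta|00\rangle+\sin\theta|11\rangle$ with $\theta\in(0,\pi/2)$, and let $|\Omega\rangle_{A'B'K}$ be an arbitrary pure state of finite-dimensional registers $A',B',K$. In the transfer model, let $\lambda_{\max}$ be the largest squared Schmidt coefficient of the pure state $|\psi(\theta)\rangle_{AB}\otimes|\Omega\rangle_{A'B'K}$ across the bipartition $AA'K\mid BB'$. Then the optimal probability, over LOCC protocols of Alice and Bob, of converting this state into a Bell pair on $AB$ (allowing arbitrary leftover systems) is $$P_{\max}=\min\bigl(1,\,2(1-\lambda_{\max})\bigr).$$
   Context: $A,B$ are qubits. Transfer model: Alice initially holds $A,A'$, Bob holds $B,B'$, and the Bank holds $K$; the Bank hands $K$ to Alice and is then absent; Alice (holding $AA'K$) and Bob (holding $BB'$) act by LOCC, i.e. local quantum operations (local ancillas and discarding of systems allowed) with finitely many rounds of classical communication between them. The probability with which an LOCC protocol yields a Bell pair on $AB$ is the total probability of those (classically known) outcomes of the protocol for which the final state of registers $A$ and $B$ is exactly $|\Phi^+\rangle=\frac{1}{\sqrt2}(|00\rangle+|11\rangle)$, the other registers being left in any state. The optimal probability is the maximum over LOCC protocols. *)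

theory Defs
  imports Complex_Main "Jordan_Normal_Form.Schur_Decomposition"
begin

text \<open>
  The joint space of a system of dimension \<open>m\<close> and a system of dimension \<open>n\<close> has
  dimension \<open>m * n\<close>; the product basis vector \<open>|i>|j>\<close> has index \<open>i * n + j\<close>.
\<close>

definition tensor_vec :: "complex vec \<Rightarrow> complex vec \<Rightarrow> complex vec" where
  "tensor_vec u v =
     vec (dim_vec u * dim_vec v) (\<lambda>i. u $ (i div dim_vec v) * v $ (i mod dim_vec v))"

definition tensor_mat :: "complex mat \<Rightarrow> complex mat \<Rightarrow> complex mat" where
  "tensor_mat M N =
     mat (dim_row M * dim_row N) (dim_col M * dim_col N)
       (\<lambda>(i, j). M $$ (i div dim_row N, j div dim_col N) * N $$ (i mod dim_row N, j mod dim_col N))"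

definition sum_mats :: "nat \<Rightarrow> complex mat list \<Rightarrow> complex mat" where
  "sum_mats n Ms = foldr (+) Ms (0\<^sub>m n n)"

definition pure_state :: "nat \<Rightarrow> complex vec \<Rightarrow> bool" where
  "pure_state n v \<longleftrightarrow> v \<in> carrier_vec n \<and> v \<bullet>c v = 1"

definition projector :: "complex vec \<Rightarrow> complex mat" where
  "projector v = mat (dim_vec v) (dim_vec v) (\<lambda>(i, j). v $ i * cnj (v $ j))"

definition mat_trace :: "complex mat \<Rightarrow> complex" where
  "mat_trace M = (\<Sum>i<dim_row M. M $$ (i, i))"


subsection \<open>Schmidt coefficients\<close>

definition orthonormal_family :: "nat \<Rightarrow> nat \<Rightarrow> (nat \<Rightarrow> complex vec) \<Rightarrow> bool" where
  "orthonormal_family n r e \<longleftrightarrow>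
     (\<forall>k<r. e k \<in> carrier_vec n) \<and> (\<forall>k<r. \<forall>l<r. e k \<bullet>c e l = (if k = l then 1 else 0))"

definition schmidt_decomposition ::
  "nat \<Rightarrow> nat \<Rightarrow> complex vec \<Rightarrow> nat \<Rightarrow> (nat \<Rightarrow> real) \<Rightarrow>
   (nat \<Rightarrow> complex vec) \<Rightarrow> (nat \<Rightarrow> complex vec) \<Rightarrow> bool" where
  "schmidt_decomposition dA dB v r c e f \<longleftrightarrow>
     v \<in> carrier_vec (dA * dB) \<and>
     (\<forall>k<r. 0 < c k) \<and> orthonormal_family dA r e \<and> orthonormal_family dB r f \<and>
     (\<forall>i<dA * dB. v $ i = (\<Sum>k<r. complex_of_real (c k) * tensor_vec (e k) (f k) $ i))"

definition schmidt_coefficients :: "nat \<Rightarrow> nat \<Rightarrow> complex vec \<Rightarrow> real set" where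
  "schmidt_coefficients dA dB v =
     {c k | r c e f k. schmidt_decomposition dA dB v r c e f \<and> k < r}"

definition lambda_max :: "nat \<Rightarrow> nat \<Rightarrow> complex vec \<Rightarrow> real" where
  "lambda_max dA dB v = Max ((\<lambda>s. s\<^sup>2) ` schmidt_coefficients dA dB v)"


subsection \<open>LOCC protocols\<close>

text \<open>
  A step is a quantum instrument applied by one party, whose classical outcome is announced to
  the other. It is a list of branches, one per classical outcome; a branch \<open>(d, Ks, P)\<close>
  consists of the dimension \<open>d\<close> of the laboratory of the acting party after the step, the
  Kraus operators of the quantum operation that belongs to the outcome, and the rest of the protocol.
  As \<open>d\<close> is arbitrary and a branch may have several Kraus operators, attaching ancillas
  and discarding systems (or measurement results) are local operations of this kind.
\<close>

datatype locc =
    Finish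
  | Alice "(nat \<times> complex mat list \<times> locc) list"
  | Bob "(nat \<times> complex mat list \<times> locc) list"

definition instrument :: "nat \<Rightarrow> (nat \<times> complex mat list) list \<Rightarrow> bool" where
  "instrument d ops \<longleftrightarrow>
     (\<forall>(d', Ks) \<in> set ops. \<forall>K \<in> set Ks. K \<in> carrier_mat d' d) \<and>
     sum_mats d (map (\<lambda>K. mat_adjoint K * K) (concat (map snd ops))) = 1\<^sub>m d"

fun locc_protocol :: "nat \<Rightarrow> nat \<Rightarrow> locc \<Rightarrow> bool" where
  "locc_protocol dA dB Finish \<longleftrightarrow> True"
| "locc_protocol dA dB (Alice bs) \<longleftrightarrow>
     instrument dA (map (\<lambda>(d, Ks, P). (d, Ks)) bs) \<and>
     (\<forall>(d, Ks, P) \<in> set bs. locc_protocol d dB P)"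
| "locc_protocol dA dB (Bob bs) \<longleftrightarrow>
     instrument dB (map (\<lambda>(d, Ks, P). (d, Ks)) bs) \<and>
     (\<forall>(d, Ks, P) \<in> set bs. locc_protocol dA d P)"

definition operation :: "nat \<Rightarrow> complex mat list \<Rightarrow> complex mat \<Rightarrow> complex mat" where
  "operation n Ks \<rho> = sum_mats n (map (\<lambda>K. K * \<rho> * mat_adjoint K) Ks)"

text \<open>
  The final outcomes of a protocol as triples of the final dimensions of the two laboratories and
  the unnormalised final state, whose trace is the probability of the outcome.
\<close>

fun outcomes :: "nat \<Rightarrow> nat \<Rightarrow> complex mat \<Rightarrow> locc \<Rightarrow> (nat \<times> nat \<times> complex mat) list" where
  "outcomes dA dB \<rho> Finish = [(dA, dB, \<rho>)]"
| "outcomes dA dB \<rho> (Alice bs) =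
     concat (map (\<lambda>(d, Ks, P).
       outcomes d dB (operation (d * dB) (map (\<lambda>K. tensor_mat K (1\<^sub>m dB)) Ks) \<rho>) P) bs)"
| "outcomes dA dB \<rho> (Bob bs) =
     concat (map (\<lambda>(d, Ks, P).
       outcomes dA d (operation (dA * d) (map (\<lambda>K. tensor_mat (1\<^sub>m dA) K) Ks) \<rho>) P) bs)"


subsection \<open>Bell pairs\<close>

text \<open>Two-qubit vectors are written in the basis \<open>|00>, |01>, |10>, |11>\<close>.\<close>

definition bell_state :: "complex vec" where
  "bell_state = vec_of_list [complex_of_real (1 / sqrt 2), 0, 0, complex_of_real (1 / sqrt 2)]"

text \<open>
  The state of the qubits A and B when Alice holds A and a system of dimension \<open>rA\<close>, and
  Bob holds B and a system of dimension \<open>rB\<close>.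
\<close>

definition reduced_AB :: "nat \<Rightarrow> nat \<Rightarrow> complex mat \<Rightarrow> complex mat" where
  "reduced_AB rA rB \<sigma> =
     (let pos = (\<lambda>i x y. ((i div 2) * rA + x) * (2 * rB) + ((i mod 2) * rB + y))
      in mat 4 4 (\<lambda>(i, j). \<Sum>x<rA. \<Sum>y<rB. \<sigma> $$ (pos i x y, pos j x y)))"

fun outcome_prob :: "nat \<times> nat \<times> complex mat \<Rightarrow> real" where
  "outcome_prob (dA, dB, \<sigma>) = Re (mat_trace \<sigma>)"

fun bell_outcome :: "nat \<times> nat \<times> complex mat \<Rightarrow> bool" where
  "bell_outcome (dA, dB, \<sigma>) \<longleftrightarrow>
     mat_trace \<sigma> \<noteq> 0 \<and>
     (\<exists>rA rB. dA = 2 * rA \<and> dB = 2 * rB \<and>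
       reduced_AB rA rB ((1 / mat_trace \<sigma>) \<cdot>\<^sub>m \<sigma>) = projector bell_state)"

definition bell_probability :: "nat \<Rightarrow> nat \<Rightarrow> complex vec \<Rightarrow> locc \<Rightarrow> real" where
  "bell_probability dA dB v P =
     (\<Sum>x \<leftarrow> filter bell_outcome (outcomes dA dB (projector v) P). outcome_prob x)"

text \<open>\<open>p\<close> is the maximum, over all LOCC protocols, of the probability to obtain a Bell pair.\<close>

definition optimal_bell_probability :: "nat \<Rightarrow> nat \<Rightarrow> complex vec \<Rightarrow> real \<Rightarrow> bool" where
  "optimal_bell_probability dA dB v p \<longleftrightarrow>
     (\<exists>P. locc_protocol dA dB P \<and> bell_probability dA dB v P = p) \<and>
     (\<forall>P. locc_protocol dA dB P \<longrightarrow> bell_probability dA dB v P \<le> p)"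


subsection \<open>The initial state of the transfer model\<close>

definition psi_state :: "real \<Rightarrow> complex vec" where
  "psi_state \<theta> = vec_of_list [complex_of_real (cos \<theta>), 0, 0, complex_of_real (sin \<theta>)]"

text \<open>
  The product of \<open>psi_state \<theta>\<close> on the registers A, B and a state of the registers
  A', B', K (in this order, of dimensions \<open>a, b, k\<close>), with the registers rearranged into
  the order A, A', K, B, B'. Thus Alice's laboratory AA'K has dimension \<open>2 * a * k\<close> and
  Bob's laboratory BB' has dimension \<open>2 * b\<close>.
\<close>

definition transfer_state :: "real \<Rightarrow> nat \<Rightarrow> nat \<Rightarrow> nat \<Rightarrow> complex vec \<Rightarrow> complex vec" where
  "transfer_state \<theta> a b k \<Omega> =
     vec ((2 * a * k) * (2 * b)) (\<lambda>n.
       let alice = n div (2 * b); bob = n mod (2 * b);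
           iA = alice div (a * k); iA' = alice div k mod a; iK = alice mod k;
           iB = bob div b; iB' = bob mod b
       in tensor_vec (psi_state \<theta>) \<Omega> $ ((iA * 2 + iB) * (a * b * k) + ((iA' * b + iB') * k + iK)))"

end

theory Submission
  imports Defs "HOL-Analysis.L2_Norm" "Jordan_Normal_Form.Spectral_Radius"
begin

text \<open>
  The statement holds for every bipartite unit vector \<open>v\<close>, read as a matrix \<open>M\<close> with
  \<open>dA\<close> rows and \<open>dB\<close> columns, so that \<open>\<lambda>\<close>, the largest squared Schmidt coefficient, is the
  squared operator norm of \<open>M\<close>.

  Upper bound: the squared norm minus the squared operator norm does not increase on average under
  local instruments, because the squared operator norm, tested on a vector that attains it, does
  not decrease on average. A branch whose qubits are in the Bell state has a block diagonal matrix
  with two equal blocks, so its squared operator norm is at most half of its squared norm.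

  Attainment: one measurement by Alice followed by one operation by Bob suffices. With squared
  Schmidt coefficients \<open>p i\<close>, Alice projects onto a pair \<open>{i, j}\<close> of Schmidt vectors, rescaled
  to equal amplitudes, with probability \<open>2 * t i j\<close>. Such a measurement exists whenever
  \<open>\<Sum>j. t i j + t j i \<le> p i\<close>, and the largest total probability that
  fractional matchings \<open>t\<close> of the Schmidt vectors allow is \<open>min 1 (2 * (1 - \<lambda>))\<close>.
\<close>

section \<open>Local operations on ensembles of vectors\<close>

text \<open>The obstacle is that a branch may carry several Kraus operators: the state in the middle
  of a protocol is mixed, whereas a coefficient matrix and its operator norm belong to a single
  vector. Every state is therefore kept as an explicit list of unnormalised vectors, and each vector
  has its own trial vector \<open>x\<close>. The bound becomes a sum over this list, and no largest
  Schmidt coefficient has to be identified between the first step and the last. The two sides are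
  not symmetric: Alice multiplies the coefficient matrix from the left, and \<open>x\<close> stays;
  Bob multiplies from the right, and \<open>x\<close> must be chosen afresh for each of his
  operators.

  The factor 2 has the same origin in both halves. In a Bell outcome at least half of the weight
  lies outside any one Schmidt direction, so one unit of \<open>1 - \<lambda>\<close> pays for at
  most two units of probability. In a matching, a dominant Schmidt vector can only be paired with
  the remaining weight \<open>1 - \<lambda>\<close>, and each unit so used yields two.\<close>

lemma sum_lessThan_mult:
  fixes f :: "nat \<Rightarrow> 'a::comm_monoid_add"
  shows "(\<Sum>i<m * n. f i) = (\<Sum>i<m. \<Sum>j<n. f (i * n + j))"
proof -
  have "(\<Sum>i<m * n. f i) = (\<Sum>i<m. sum f {i * n..<i * n + n})"
    by (rule sum.nat_group[symmetric])
  also have "\<dots> = (\<Sum>i<m. \<Sum>j<n. f (i * n + j))"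
  proof (rule sum.cong[OF refl])
    fix i
    have "sum f {0 + i * n..<n + i * n} = (\<Sum>j = 0..<n. f (j + i * n))"
      by (rule sum.shift_bounds_nat_ivl)
    thus "sum f {i * n..<i * n + n} = (\<Sum>j<n. f (i * n + j))"
      by (simp add: add.commute atLeast0LessThan)
  qed
  finally show ?thesis .
qed

lemma prod_index_less:
  fixes i j m n :: nat
  assumes "i < m" "j < n"
  shows "i * n + j < m * n"
proof -
  have "i * n + j < Suc i * n" using assms by simp
  also have "\<dots> \<le> m * n" using assms by (intro mult_right_mono) auto
  finally show ?thesis .
qed

lemma dim_sum_mats: "\<forall>M\<in>set Ms. M \<in> carrier_mat n n \<Longrightarrow> sum_mats n Ms \<in> carrier_mat n n"
  by (induction Ms) (auto simp: sum_mats_def)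

lemma index_sum_mats:
  assumes "\<forall>M\<in>set Ms. M \<in> carrier_mat n n" "i < n" "j < n"
  shows "sum_mats n Ms $$ (i, j) = (\<Sum>M\<leftarrow>Ms. M $$ (i, j))"
  using assms
proof (induction Ms)
  case (Cons M Ms)
  have "sum_mats n Ms \<in> carrier_mat n n"
    using Cons.prems by (intro dim_sum_mats) auto
  thus ?case using Cons by (auto simp: sum_mats_def)
qed (auto simp: sum_mats_def)

lemma mat_adjoint_carrier [simp]:
  assumes "K \<in> carrier_mat m n"
  shows "mat_adjoint K \<in> carrier_mat n m"
proof (rule carrier_matI)
  show "dim_row (mat_adjoint K) = n" "dim_col (mat_adjoint K) = m"
    using carrier_matD[OF assms] by (simp_all add: mat_adjoint_def)
qed

lemma index_mat_adjoint:
  assumes "K \<in> carrier_mat m n" "i < n" "j < m"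
  shows "mat_adjoint K $$ (i, j) = cnj (K $$ (j, i))"
proof -
  note d = carrier_matD[OF assms(1)]
  have "mat_adjoint K $$ (i, j) = conjugate (col K i) $ j"
    using d assms(2,3) by (simp add: mat_adjoint_def mat_of_rows_index)
  thus ?thesis using d assms(2,3) by simp
qed

lemma tensor_mat_carrier [simp]:
  "K \<in> carrier_mat m n \<Longrightarrow> L \<in> carrier_mat m' n' \<Longrightarrow> tensor_mat K L \<in> carrier_mat (m * m') (n * n')"
  unfolding tensor_mat_def by auto

lemma index_mult_mat_vec_sum:
  assumes "K \<in> carrier_mat m n" "w \<in> carrier_vec n" "i < m"
  shows "(K *\<^sub>v w) $ i = (\<Sum>l<n. K $$ (i, l) * w $ l)"
  using assms by (auto simp: scalar_prod_def atLeast0LessThan)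

lemma index_tensor_left:
  assumes K: "K \<in> carrier_mat d dA" and w: "w \<in> carrier_vec (dA * dB)" and ij: "i < d" "j < dB"
  shows "(tensor_mat K (1\<^sub>m dB) *\<^sub>v w) $ (i * dB + j) = (\<Sum>l<dA. K $$ (i, l) * w $ (l * dB + j))"
proof -
  have "(tensor_mat K (1\<^sub>m dB) *\<^sub>v w) $ (i * dB + j)
      = (\<Sum>l<dA * dB. tensor_mat K (1\<^sub>m dB) $$ (i * dB + j, l) * w $ l)"
    using K w ij by (intro index_mult_mat_vec_sum[where m = "d * dB"]) (auto intro: prod_index_less)
  also have "\<dots> = (\<Sum>l<dA. \<Sum>q<dB. K $$ (i, l) * w $ (l * dB + q) * (if j = q then 1 else 0))"
    unfolding sum_lessThan_mult tensor_mat_def using K ij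
    by (intro sum.cong refl) (auto simp: prod_index_less)
  also have "\<dots> = (\<Sum>l<dA. K $$ (i, l) * w $ (l * dB + j))"
    using ij by (intro sum.cong refl) (simp add: if_distrib[of "(*) _"] cong: if_cong)
  finally show ?thesis .
qed

lemma index_tensor_right:
  assumes K: "K \<in> carrier_mat d dB" and w: "w \<in> carrier_vec (dA * dB)" and ij: "i < dA" "j < d"
  shows "(tensor_mat (1\<^sub>m dA) K *\<^sub>v w) $ (i * d + j) = (\<Sum>l<dB. K $$ (j, l) * w $ (i * dB + l))"
proof -
  have "(tensor_mat (1\<^sub>m dA) K *\<^sub>v w) $ (i * d + j)
      = (\<Sum>l<dA * dB. tensor_mat (1\<^sub>m dA) K $$ (i * d + j, l) * w $ l)"
    using K w ij by (intro index_mult_mat_vec_sum[where m = "dA * d"]) (auto intro: prod_index_less)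
  also have "\<dots> = (\<Sum>l<dA. \<Sum>q<dB. (if i = l then K $$ (j, q) * w $ (l * dB + q) else 0))"
    unfolding sum_lessThan_mult tensor_mat_def using K ij
    by (intro sum.cong refl) (auto simp: prod_index_less)
  also have "\<dots> = (\<Sum>l<dA. if i = l then \<Sum>q<dB. K $$ (j, q) * w $ (l * dB + q) else 0)"
    by (intro sum.cong refl) auto
  also have "\<dots> = (\<Sum>l<dB. K $$ (j, l) * w $ (i * dB + l))"
    using ij by simp
  finally show ?thesis .
qed

text \<open>An unnormalised mixed state given by a list of vectors. Keeping the list, and not only
  the matrix, gives access to norms and overlaps of single vectors after a coarse-grained
  outcome.\<close>

definition ensemble :: "nat \<Rightarrow> complex vec list \<Rightarrow> complex mat" where
  "ensemble n ws = sum_mats n (map projector ws)"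

lemma projector_carrier [simp]: "w \<in> carrier_vec n \<Longrightarrow> projector w \<in> carrier_mat n n"
  by (auto simp: projector_def)

lemma ensemble_carrier: "\<forall>w\<in>set ws. w \<in> carrier_vec n \<Longrightarrow> ensemble n ws \<in> carrier_mat n n"
  unfolding ensemble_def by (intro dim_sum_mats) auto

lemma index_ensemble:
  assumes "\<forall>w\<in>set ws. w \<in> carrier_vec n" "i < n" "j < n"
  shows "ensemble n ws $$ (i, j) = (\<Sum>w\<leftarrow>ws. w $ i * cnj (w $ j))"
proof -
  have "ensemble n ws $$ (i, j) = (\<Sum>M\<leftarrow>map projector ws. M $$ (i, j))"
    unfolding ensemble_def using assms by (intro index_sum_mats) auto
  also have "\<dots> = (\<Sum>w\<leftarrow>ws. w $ i * cnj (w $ j))"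
    unfolding map_map o_def
  proof (intro arg_cong[where f = sum_list] map_cong refl)
    fix w assume "w \<in> set ws"
    hence "dim_vec w = n" using assms(1) by auto
    thus "projector w $$ (i, j) = w $ i * cnj (w $ j)"
      using assms(2,3) by (simp add: projector_def)
  qed
  finally show ?thesis .
qed

lemma ensemble_singleton: "w \<in> carrier_vec n \<Longrightarrow> ensemble n [w] = projector w"
  by (simp add: ensemble_def sum_mats_def)

lemma index_mult_mat_sum:
  assumes "K \<in> carrier_mat m n" "L \<in> carrier_mat n p" "i < m" "j < p"
  shows "(K * L) $$ (i, j) = (\<Sum>l<n. K $$ (i, l) * L $$ (l, j))"
  using assms by (auto simp: scalar_prod_def atLeast0LessThan)

lemma index_conjugation:
  assumes K: "K \<in> carrier_mat n m" and R: "R \<in> carrier_mat m m" and ij: "i < n" "j < n"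
  shows "(K * R * mat_adjoint K) $$ (i, j)
    = (\<Sum>q<m. (\<Sum>p<m. K $$ (i, p) * R $$ (p, q)) * cnj (K $$ (j, q)))"
proof -
  have KR: "K * R \<in> carrier_mat n m" using K R by auto
  show ?thesis
    unfolding index_mult_mat_sum[OF KR mat_adjoint_carrier[OF K] ij]
    using ij by (intro sum.cong refl)
      (simp add: index_mult_mat_sum[OF K R] index_mat_adjoint[OF K])
qed

lemma sum_sum_list_swap:
  fixes f :: "'a \<Rightarrow> 'b \<Rightarrow> 'c::comm_monoid_add"
  shows "(\<Sum>i\<in>A. \<Sum>x\<leftarrow>xs. f i x) = (\<Sum>x\<leftarrow>xs. \<Sum>i\<in>A. f i x)"
  by (induction xs) (auto simp: sum.distrib)

lemma sum_list_swap:
  fixes f :: "'a \<Rightarrow> 'b \<Rightarrow> 'c::comm_monoid_add"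
  shows "(\<Sum>y\<leftarrow>ys. \<Sum>x\<leftarrow>xs. f y x) = (\<Sum>x\<leftarrow>xs. \<Sum>y\<leftarrow>ys. f y x)"
  by (induction xs) (auto simp: sum_list_addf)

lemma sum_list_concat_map:
  fixes f :: "'b \<Rightarrow> 'c::comm_monoid_add"
  shows "(\<Sum>y\<leftarrow>concat (map g xs). f y) = (\<Sum>x\<leftarrow>xs. \<Sum>y\<leftarrow>g x. f y)"
  by (induction xs) auto

lemma of_real_sum_list_map: "of_real (\<Sum>x\<leftarrow>xs. f x) = (\<Sum>x\<leftarrow>xs. of_real (f x) :: 'a::real_algebra_1)"
  by (induction xs) auto

text \<open>\<open>K\<close> sends the projector of \<open>w\<close> to the projector of
  \<open>K *\<^sub>v w\<close>, so mixed states stay lists of vectors. The new list is grouped by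
  Kraus operator, the order in which the induction over protocols sums it.\<close>

lemma operation_ensemble:
  assumes Ks: "\<forall>K\<in>set Ks. K \<in> carrier_mat n m" and ws: "\<forall>w\<in>set ws. w \<in> carrier_vec m"
  shows "operation n Ks (ensemble m ws) = ensemble n (concat (map (\<lambda>K. map (\<lambda>w. K *\<^sub>v w) ws) Ks))"
    (is "?L = ensemble n ?vs")
proof (rule eq_matI)
  have R: "ensemble m ws \<in> carrier_mat m m" by (rule ensemble_carrier[OF ws])
  have vs: "\<forall>v\<in>set ?vs. v \<in> carrier_vec n"
  proof
    fix v assume "v \<in> set ?vs"
    then obtain K w where Kw: "K \<in> set Ks" "w \<in> set ws" "v = K *\<^sub>v w" by auto
    with Ks ws have "K \<in> carrier_mat n m" "w \<in> carrier_vec m" by blast+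
    thus "v \<in> carrier_vec n" unfolding Kw(3) by (rule mult_mat_vec_carrier)
  qed
  have cK: "\<forall>M\<in>set (map (\<lambda>K. K * ensemble m ws * mat_adjoint K) Ks). M \<in> carrier_mat n n"
  proof
    fix M assume "M \<in> set (map (\<lambda>K. K * ensemble m ws * mat_adjoint K) Ks)"
    then obtain K where K: "K \<in> set Ks" "M = K * ensemble m ws * mat_adjoint K" by auto
    with Ks have "K \<in> carrier_mat n m" by blast
    thus "M \<in> carrier_mat n n"
      unfolding K(2) using R by (intro mult_carrier_mat[where n = m] mat_adjoint_carrier)
  qed
  have L: "?L \<in> carrier_mat n n" unfolding operation_def by (rule dim_sum_mats[OF cK])
  note E = ensemble_carrier[OF vs]
  show "dim_row ?L = dim_row (ensemble n ?vs)" "dim_col ?L = dim_col (ensemble n ?vs)"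
    using L E by auto
  fix i j assume "i < dim_row (ensemble n ?vs)" "j < dim_col (ensemble n ?vs)"
  hence ij: "i < n" "j < n" using E by auto
  have "?L $$ (i, j) = (\<Sum>K\<leftarrow>Ks. (K * ensemble m ws * mat_adjoint K) $$ (i, j))"
    unfolding operation_def index_sum_mats[OF cK ij] by (simp add: o_def)
  also have "\<dots> = (\<Sum>K\<leftarrow>Ks. \<Sum>w\<leftarrow>ws. (K *\<^sub>v w) $ i * cnj ((K *\<^sub>v w) $ j))"
  proof (intro arg_cong[where f = sum_list] map_cong refl)
    fix K assume "K \<in> set Ks"
    hence K: "K \<in> carrier_mat n m" using Ks by auto
    have "(K * ensemble m ws * mat_adjoint K) $$ (i, j)
        = (\<Sum>q<m. (\<Sum>p<m. K $$ (i, p) * (\<Sum>w\<leftarrow>ws. w $ p * cnj (w $ q))) * cnj (K $$ (j, q)))"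
      unfolding index_conjugation[OF K R ij] by (simp add: index_ensemble[OF ws])
    also have "\<dots> = (\<Sum>q<m. \<Sum>p<m. \<Sum>w\<leftarrow>ws. K $$ (i, p) * w $ p * cnj (K $$ (j, q) * w $ q))"
    proof -
      have "K $$ (i, p) * (\<Sum>w\<leftarrow>ws. w $ p * cnj (w $ q)) * cnj (K $$ (j, q))
          = (\<Sum>w\<leftarrow>ws. K $$ (i, p) * w $ p * cnj (K $$ (j, q) * w $ q))" for p q
        by (induction ws) (auto simp: algebra_simps)
      thus ?thesis by (simp only: sum_distrib_right)
    qed
    also have "\<dots> = (\<Sum>w\<leftarrow>ws. \<Sum>q<m. \<Sum>p<m. K $$ (i, p) * w $ p * cnj (K $$ (j, q) * w $ q))"
      by (simp only: sum_sum_list_swap)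
    also have "\<dots> = (\<Sum>w\<leftarrow>ws. (K *\<^sub>v w) $ i * cnj ((K *\<^sub>v w) $ j))"
    proof (intro arg_cong[where f = sum_list] map_cong refl)
      fix w assume "w \<in> set ws"
      hence w: "w \<in> carrier_vec m" using ws by auto
      show "(\<Sum>q<m. \<Sum>p<m. K $$ (i, p) * w $ p * cnj (K $$ (j, q) * w $ q))
          = (K *\<^sub>v w) $ i * cnj ((K *\<^sub>v w) $ j)"
        unfolding index_mult_mat_vec_sum[OF K w ij(1)] index_mult_mat_vec_sum[OF K w ij(2)]
        unfolding sum_product cnj_sum by (rule sum.swap)
    qed
    finally show "(K * ensemble m ws * mat_adjoint K) $$ (i, j)
      = (\<Sum>w\<leftarrow>ws. (K *\<^sub>v w) $ i * cnj ((K *\<^sub>v w) $ j))" .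
  qed
  also have "\<dots> = ensemble n ?vs $$ (i, j)"
    unfolding index_ensemble[OF vs ij] sum_list_concat_map by (simp add: o_def)
  finally show "?L $$ (i, j) = ensemble n ?vs $$ (i, j)" .
qed

section \<open>Norms and the completeness relation of an instrument\<close>

definition norm_sq :: "complex vec \<Rightarrow> real" where
  "norm_sq w = (\<Sum>i<dim_vec w. (cmod (w $ i))\<^sup>2)"

lemma mat_trace_ensemble:
  assumes "\<forall>w\<in>set ws. w \<in> carrier_vec n"
  shows "mat_trace (ensemble n ws) = complex_of_real (\<Sum>w\<leftarrow>ws. norm_sq w)"
proof -
  have "mat_trace (ensemble n ws) = (\<Sum>i<n. \<Sum>w\<leftarrow>ws. w $ i * cnj (w $ i))"
    using index_ensemble[OF assms] carrier_matD(1)[OF ensemble_carrier[OF assms]]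
    by (simp add: mat_trace_def)
  also have "\<dots> = (\<Sum>w\<leftarrow>ws. \<Sum>i<n. w $ i * cnj (w $ i))" by (rule sum_sum_list_swap)
  also have "\<dots> = (\<Sum>w\<leftarrow>ws. complex_of_real (norm_sq w))"
  proof (intro arg_cong[where f = sum_list] map_cong refl)
    fix w assume "w \<in> set ws"
    hence "dim_vec w = n" using assms by auto
    thus "(\<Sum>i<n. w $ i * cnj (w $ i)) = complex_of_real (norm_sq w)"
      by (simp only: norm_sq_def of_real_sum complex_norm_square)
  qed
  also have "\<dots> = complex_of_real (\<Sum>w\<leftarrow>ws. norm_sq w)"
    by (rule of_real_sum_list_map[symmetric])
  finally show ?thesis .
qed

lemma norm_sq_bipartite:
  "w \<in> carrier_vec (m * n) \<Longrightarrow> norm_sq w = (\<Sum>i<m. \<Sum>j<n. (cmod (w $ (i * n + j)))\<^sup>2)"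
  by (simp only: norm_sq_def sum_lessThan_mult carrier_vecD)

text \<open>The squared norm of \<open>A u\<close> as a quadratic form of the Gram matrix of the
  columns of \<open>A\<close>. Completeness of an instrument and orthonormality of a family are both
  statements on such Gram matrices, so \<open>instrument_norm\<close> and
  \<open>norm_orthonormal_combination\<close> both rest on it.\<close>

lemma cmod_square_sum_expand:
  "complex_of_real (\<Sum>i<r. (cmod (\<Sum>l<d. A i l * u l))\<^sup>2)
    = (\<Sum>m<d. \<Sum>l<d. u m * cnj (u l) * (\<Sum>i<r. cnj (A i l) * A i m))"
proof -
  have "complex_of_real (\<Sum>i<r. (cmod (\<Sum>l<d. A i l * u l))\<^sup>2)
      = (\<Sum>i<r. (\<Sum>m<d. A i m * u m) * cnj (\<Sum>l<d. A i l * u l))"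
    by (simp only: of_real_sum complex_norm_square)
  also have "\<dots> = (\<Sum>i<r. \<Sum>m<d. \<Sum>l<d. u m * cnj (u l) * (cnj (A i l) * A i m))"
    by (simp add: cnj_sum sum_product mult_ac)
  also have "\<dots> = (\<Sum>m<d. \<Sum>i<r. \<Sum>l<d. u m * cnj (u l) * (cnj (A i l) * A i m))"
    by (rule sum.swap)
  also have "\<dots> = (\<Sum>m<d. \<Sum>l<d. \<Sum>i<r. u m * cnj (u l) * (cnj (A i l) * A i m))"
    by (intro sum.cong refl) (rule sum.swap)
  finally show ?thesis by (simp only: sum_distrib_left)
qed

text \<open>The carrier assumption fixes only the number of columns: Kraus operators of different
  branches may differ in output dimension and still share one completeness sum.\<close>

lemma index_sum_mats_adjoint_mult:
  assumes Ks: "\<forall>K\<in>set Ks. K \<in> carrier_mat (dim_row K) d" and lm: "l < d" "m < d"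
  shows "sum_mats d (map (\<lambda>K. mat_adjoint K * K) Ks) $$ (l, m)
    = (\<Sum>K\<leftarrow>Ks. \<Sum>i<dim_row K. cnj (K $$ (i, l)) * K $$ (i, m))"
proof -
  have c: "\<forall>M\<in>set (map (\<lambda>K. mat_adjoint K * K) Ks). M \<in> carrier_mat d d"
  proof
    fix M assume "M \<in> set (map (\<lambda>K. mat_adjoint K * K) Ks)"
    then obtain K where K: "K \<in> set Ks" "M = mat_adjoint K * K" by auto
    from Ks K(1) have "K \<in> carrier_mat (dim_row K) d" by blast
    thus "M \<in> carrier_mat d d"
      unfolding K(2) by (intro mult_carrier_mat mat_adjoint_carrier)
  qed
  have "sum_mats d (map (\<lambda>K. mat_adjoint K * K) Ks) $$ (l, m)
      = (\<Sum>K\<leftarrow>Ks. (mat_adjoint K * K) $$ (l, m))"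
    unfolding index_sum_mats[OF c lm] by (simp add: o_def)
  also have "\<dots> = (\<Sum>K\<leftarrow>Ks. \<Sum>i<dim_row K. cnj (K $$ (i, l)) * K $$ (i, m))"
  proof (intro arg_cong[where f = sum_list] map_cong refl)
    fix K assume "K \<in> set Ks"
    hence K: "K \<in> carrier_mat (dim_row K) d" using Ks by blast
    show "(mat_adjoint K * K) $$ (l, m) = (\<Sum>i<dim_row K. cnj (K $$ (i, l)) * K $$ (i, m))"
      unfolding index_mult_mat_sum[OF mat_adjoint_carrier[OF K] K lm]
      using index_mat_adjoint[OF K lm(1)] by (intro sum.cong refl) simp
  qed
  finally show ?thesis .
qed

lemma instrument_carrier:
  assumes "instrument d ops" "K \<in> set (concat (map snd ops))"
  shows "K \<in> carrier_mat (dim_row K) d"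
proof -
  from assms(2) obtain d' Ls where "(d', Ls) \<in> set ops" "K \<in> set Ls" by auto
  hence "K \<in> carrier_mat d' d" using assms(1) unfolding instrument_def by blast
  thus ?thesis by auto
qed

lemma instrument_gram:
  assumes I: "instrument d ops" and lm: "l < d" "m < d"
  shows "(\<Sum>K\<leftarrow>concat (map snd ops). \<Sum>i<dim_row K. cnj (K $$ (i, l)) * K $$ (i, m))
    = (if l = m then 1 else 0)"
proof -
  have "\<forall>K\<in>set (concat (map snd ops)). K \<in> carrier_mat (dim_row K) d"
    using instrument_carrier[OF I] by blast
  from index_sum_mats_adjoint_mult[OF this lm] show ?thesis
    using I lm by (simp add: instrument_def)
qed

lemma instrumentI:
  assumes c: "\<And>d' Ks K. (d', Ks) \<in> set ops \<Longrightarrow> K \<in> set Ks \<Longrightarrow> K \<in> carrier_mat d' d"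
    and gram: "\<And>l m. l < d \<Longrightarrow> m < d \<Longrightarrow>
      (\<Sum>K\<leftarrow>concat (map snd ops). \<Sum>i<dim_row K. cnj (K $$ (i, l)) * K $$ (i, m)) = (if l = m then 1 else 0)"
  shows "instrument d ops"
proof -
  let ?Ks = "concat (map snd ops)"
  have Ks: "\<forall>K\<in>set ?Ks. K \<in> carrier_mat (dim_row K) d"
  proof
    fix K assume "K \<in> set ?Ks"
    then obtain d' Ls where "(d', Ls) \<in> set ops" "K \<in> set Ls" by auto
    from c[OF this] show "K \<in> carrier_mat (dim_row K) d" by auto
  qed
  have "\<forall>M\<in>set (map (\<lambda>K. mat_adjoint K * K) ?Ks). M \<in> carrier_mat d d"
  proof
    fix M assume "M \<in> set (map (\<lambda>K. mat_adjoint K * K) ?Ks)"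
    then obtain K where K: "K \<in> set ?Ks" "M = mat_adjoint K * K" by auto
    from Ks K(1) have "K \<in> carrier_mat (dim_row K) d" by blast
    thus "M \<in> carrier_mat d d"
      unfolding K(2) by (intro mult_carrier_mat mat_adjoint_carrier)
  qed
  note S = dim_sum_mats[OF this]
  have "sum_mats d (map (\<lambda>K. mat_adjoint K * K) ?Ks) = 1\<^sub>m d"
  proof (rule eq_matI)
    fix l m assume "l < dim_row (1\<^sub>m d)" "m < dim_col (1\<^sub>m d)"
    hence lm: "l < d" "m < d" by auto
    show "sum_mats d (map (\<lambda>K. mat_adjoint K * K) ?Ks) $$ (l, m) = 1\<^sub>m d $$ (l, m)"
      unfolding index_sum_mats_adjoint_mult[OF Ks lm] gram[OF lm] using lm by simp
  qed (use S in auto)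
  thus ?thesis using c unfolding instrument_def by blast
qed

text \<open>Completeness says that the stacked Kraus operators form an isometry. The input
  \<open>u\<close> is a function because it is used for the columns and rows of a coefficient matrix
  \<open>M\<close>, for its image \<open>M x\<close>, and for \<open>z\<close> in
  \<open>bob_overlap\<close>.\<close>

lemma instrument_norm:
  assumes I: "instrument d ops"
  shows "(\<Sum>K\<leftarrow>concat (map snd ops). \<Sum>i<dim_row K. (cmod (\<Sum>l<d. K $$ (i, l) * u l))\<^sup>2)
    = (\<Sum>l<d. (cmod (u l))\<^sup>2)"
proof -
  define Ks where "Ks = concat (map snd ops)"
  have "complex_of_real (\<Sum>K\<leftarrow>Ks. \<Sum>i<dim_row K. (cmod (\<Sum>l<d. K $$ (i, l) * u l))\<^sup>2)
     = (\<Sum>K\<leftarrow>Ks. \<Sum>m<d. \<Sum>l<d. u m * cnj (u l) * (\<Sum>i<dim_row K. cnj (K $$ (i, l)) * K $$ (i, m)))"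
    by (simp only: of_real_sum_list_map cmod_square_sum_expand)
  also have "\<dots> = (\<Sum>m<d. \<Sum>l<d. u m * cnj (u l) * (\<Sum>K\<leftarrow>Ks. \<Sum>i<dim_row K. cnj (K $$ (i, l)) * K $$ (i, m)))"
    by (simp only: sum_sum_list_swap[symmetric] sum_list_const_mult)
  also have "\<dots> = (\<Sum>m<d. \<Sum>l<d. u m * cnj (u l) * (if l = m then 1 else 0))"
    unfolding Ks_def by (intro sum.cong refl) (simp add: instrument_gram[OF I])
  also have "\<dots> = (\<Sum>m<d. u m * cnj (u m))"
    by (simp add: if_distrib[of "(*) _"] cong: if_cong)
  also have "\<dots> = complex_of_real (\<Sum>l<d. (cmod (u l))\<^sup>2)"
    by (simp only: of_real_sum complex_norm_square)
  finally show ?thesis by (simp only: of_real_eq_iff Ks_def)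
qed

section \<open>The upper bound\<close>

text \<open>Works on an outcome list instead of a protocol, so that the induction can speak about
  subprotocols that start from mixed, unnormalised states.\<close>

definition final_bell_probability :: "(nat \<times> nat \<times> complex mat) list \<Rightarrow> real" where
  "final_bell_probability os = (\<Sum>x\<leftarrow>filter bell_outcome os. outcome_prob x)"

lemma final_bell_probability_concat:
  "final_bell_probability (concat oss) = (\<Sum>os\<leftarrow>oss. final_bell_probability os)"
  by (induction oss) (auto simp: final_bell_probability_def)

text \<open>The squared norm of \<open>M x\<close>, with \<open>M\<close> the coefficient matrix of
  \<open>w\<close>. Since \<open>x\<close> enters without conjugation, the trial vector used in
  \<open>lambda_max_overlap\<close> is the conjugate of one of Bob's Schmidt vectors.\<close>

definition overlap :: "nat \<Rightarrow> nat \<Rightarrow> complex vec \<Rightarrow> (nat \<Rightarrow> complex) \<Rightarrow> real" where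
  "overlap dA dB w x = (\<Sum>i<dA. (cmod (\<Sum>j<dB. w $ (i * dB + j) * x j))\<^sup>2)"

lemma overlap_nonneg: "0 \<le> overlap dA dB w x"
  unfolding overlap_def by (intro sum_nonneg) auto

lemma Cauchy_Schwarz_complex_sum:
  fixes a b :: "'a \<Rightarrow> complex"
  shows "(cmod (\<Sum>i\<in>A. a i * b i))\<^sup>2 \<le> (\<Sum>i\<in>A. (cmod (a i))\<^sup>2) * (\<Sum>i\<in>A. (cmod (b i))\<^sup>2)"
proof -
  have "cmod (\<Sum>i\<in>A. a i * b i) \<le> (\<Sum>i\<in>A. cmod (a i * b i))" by (rule norm_sum)
  also have "\<dots> = (\<Sum>i\<in>A. \<bar>cmod (a i)\<bar> * \<bar>cmod (b i)\<bar>)" by (simp add: norm_mult)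
  also have "\<dots> \<le> L2_set (\<lambda>i. cmod (a i)) A * L2_set (\<lambda>i. cmod (b i)) A"
    by (rule L2_set_mult_ineq)
  finally have "(cmod (\<Sum>i\<in>A. a i * b i))\<^sup>2
      \<le> (L2_set (\<lambda>i. cmod (a i)) A * L2_set (\<lambda>i. cmod (b i)) A)\<^sup>2"
    by (intro power_mono) auto
  thus ?thesis by (simp add: L2_set_def power_mult_distrib sum_nonneg)
qed

lemma norm_sq_tensor_left:
  assumes K: "K \<in> carrier_mat d dA" and w: "w \<in> carrier_vec (dA * dB)"
  shows "norm_sq (tensor_mat K (1\<^sub>m dB) *\<^sub>v w)
    = (\<Sum>j<dB. \<Sum>i<d. (cmod (\<Sum>l<dA. K $$ (i, l) * w $ (l * dB + j)))\<^sup>2)"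
proof -
  have c: "tensor_mat K (1\<^sub>m dB) *\<^sub>v w \<in> carrier_vec (d * dB)"
    using K w by (intro mult_mat_vec_carrier[where n = "dA * dB"] tensor_mat_carrier) auto
  show ?thesis
    unfolding norm_sq_bipartite[OF c] by (subst sum.swap) (simp add: index_tensor_left[OF K w])
qed

lemma norm_sq_tensor_right:
  assumes K: "K \<in> carrier_mat d dB" and w: "w \<in> carrier_vec (dA * dB)"
  shows "norm_sq (tensor_mat (1\<^sub>m dA) K *\<^sub>v w)
    = (\<Sum>i<dA. \<Sum>j<d. (cmod (\<Sum>l<dB. K $$ (j, l) * w $ (i * dB + l)))\<^sup>2)"
proof -
  have c: "tensor_mat (1\<^sub>m dA) K *\<^sub>v w \<in> carrier_vec (dA * d)"
    using K w by (intro mult_mat_vec_carrier[where n = "dA * dB"] tensor_mat_carrier) auto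
  show ?thesis
    unfolding norm_sq_bipartite[OF c] by (simp add: index_tensor_right[OF K w])
qed

text \<open>Alice turns the coefficient matrix \<open>M\<close> into \<open>K M\<close>, so
  \<open>instrument_norm\<close> applies to each column, that is, for each fixed
  \<open>j\<close>.\<close>

lemma alice_norm:
  assumes I: "instrument dA ops" and w: "w \<in> carrier_vec (dA * dB)"
  shows "(\<Sum>K\<leftarrow>concat (map snd ops). norm_sq (tensor_mat K (1\<^sub>m dB) *\<^sub>v w)) = norm_sq w"
proof -
  define Ks where "Ks = concat (map snd ops)"
  have "(\<Sum>K\<leftarrow>Ks. norm_sq (tensor_mat K (1\<^sub>m dB) *\<^sub>v w))
      = (\<Sum>K\<leftarrow>Ks. \<Sum>j<dB. \<Sum>i<dim_row K. (cmod (\<Sum>l<dA. K $$ (i, l) * w $ (l * dB + j)))\<^sup>2)"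
    unfolding Ks_def
    by (intro arg_cong[where f = sum_list] map_cong refl norm_sq_tensor_left
        instrument_carrier[OF I] w)
  also have "\<dots> = (\<Sum>j<dB. \<Sum>K\<leftarrow>Ks. \<Sum>i<dim_row K. (cmod (\<Sum>l<dA. K $$ (i, l) * w $ (l * dB + j)))\<^sup>2)"
    by (rule sum_sum_list_swap[symmetric])
  also have "\<dots> = (\<Sum>j<dB. \<Sum>l<dA. (cmod (w $ (l * dB + j)))\<^sup>2)"
    unfolding Ks_def by (intro sum.cong refl instrument_norm[OF I])
  also have "\<dots> = (\<Sum>l<dA. \<Sum>j<dB. (cmod (w $ (l * dB + j)))\<^sup>2)" by (rule sum.swap)
  also have "\<dots> = norm_sq w" by (rule norm_sq_bipartite[OF w, symmetric])
  finally show ?thesis unfolding Ks_def .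
qed

text \<open>\<open>K M x\<close> is \<open>K\<close> applied to the fixed vector \<open>M x\<close>,
  whose squared norm the instrument distributes over the Kraus operators. Hence the same
  \<open>x\<close> serves every branch, with equality.\<close>

lemma alice_overlap:
  assumes I: "instrument dA ops" and w: "w \<in> carrier_vec (dA * dB)"
  shows "(\<Sum>K\<leftarrow>concat (map snd ops). overlap (dim_row K) dB (tensor_mat K (1\<^sub>m dB) *\<^sub>v w) x)
    = overlap dA dB w x"
proof -
  define Ks where "Ks = concat (map snd ops)"
  have "(\<Sum>K\<leftarrow>Ks. overlap (dim_row K) dB (tensor_mat K (1\<^sub>m dB) *\<^sub>v w) x)
      = (\<Sum>K\<leftarrow>Ks. \<Sum>i<dim_row K. (cmod (\<Sum>l<dA. K $$ (i, l) * (\<Sum>j<dB. w $ (l * dB + j) * x j)))\<^sup>2)"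
  proof (intro arg_cong[where f = sum_list] map_cong refl)
    fix K assume "K \<in> set Ks"
    hence K: "K \<in> carrier_mat (dim_row K) dA" unfolding Ks_def by (rule instrument_carrier[OF I])
    have "(\<Sum>j<dB. (tensor_mat K (1\<^sub>m dB) *\<^sub>v w) $ (i * dB + j) * x j)
        = (\<Sum>l<dA. K $$ (i, l) * (\<Sum>j<dB. w $ (l * dB + j) * x j))" if "i < dim_row K" for i
    proof -
      have "(\<Sum>j<dB. (tensor_mat K (1\<^sub>m dB) *\<^sub>v w) $ (i * dB + j) * x j)
          = (\<Sum>j<dB. \<Sum>l<dA. K $$ (i, l) * (w $ (l * dB + j) * x j))"
        using that by (intro sum.cong refl)
          (simp add: index_tensor_left[OF K w] sum_distrib_right mult.assoc)
      also have "\<dots> = (\<Sum>l<dA. \<Sum>j<dB. K $$ (i, l) * (w $ (l * dB + j) * x j))" by (rule sum.swap)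
      finally show ?thesis by (simp only: sum_distrib_left)
    qed
    thus "overlap (dim_row K) dB (tensor_mat K (1\<^sub>m dB) *\<^sub>v w) x
        = (\<Sum>i<dim_row K. (cmod (\<Sum>l<dA. K $$ (i, l) * (\<Sum>j<dB. w $ (l * dB + j) * x j)))\<^sup>2)"
      unfolding overlap_def by simp
  qed
  also have "\<dots> = overlap dA dB w x"
    unfolding Ks_def overlap_def by (rule instrument_norm[OF I])
  finally show ?thesis unfolding Ks_def .
qed

text \<open>Bob multiplies \<open>M\<close> from the right by the transpose of \<open>K\<close>;
  \<open>instrument_norm\<close> applies to each row.\<close>

lemma bob_norm:
  assumes I: "instrument dB ops" and w: "w \<in> carrier_vec (dA * dB)"
  shows "(\<Sum>K\<leftarrow>concat (map snd ops). norm_sq (tensor_mat (1\<^sub>m dA) K *\<^sub>v w)) = norm_sq w"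
proof -
  define Ks where "Ks = concat (map snd ops)"
  have "(\<Sum>K\<leftarrow>Ks. norm_sq (tensor_mat (1\<^sub>m dA) K *\<^sub>v w))
      = (\<Sum>K\<leftarrow>Ks. \<Sum>i<dA. \<Sum>j<dim_row K. (cmod (\<Sum>l<dB. K $$ (j, l) * w $ (i * dB + l)))\<^sup>2)"
    unfolding Ks_def
    by (intro arg_cong[where f = sum_list] map_cong refl norm_sq_tensor_right
        instrument_carrier[OF I] w)
  also have "\<dots> = (\<Sum>i<dA. \<Sum>K\<leftarrow>Ks. \<Sum>j<dim_row K. (cmod (\<Sum>l<dB. K $$ (j, l) * w $ (i * dB + l)))\<^sup>2)"
    by (rule sum_sum_list_swap[symmetric])
  also have "\<dots> = (\<Sum>i<dA. \<Sum>l<dB. (cmod (w $ (i * dB + l)))\<^sup>2)"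
    unfolding Ks_def by (intro sum.cong refl instrument_norm[OF I])
  also have "\<dots> = norm_sq w" by (rule norm_sq_bipartite[OF w, symmetric])
  finally show ?thesis unfolding Ks_def .
qed

text \<open>The equality case of Cauchy-Schwarz. The norm is only required to be at most 1, so that
  \<open>z = 0\<close>, and with it \<open>n = 0\<close>, is served by the zero vector.\<close>

lemma normalized_conjugate_witness:
  fixes z :: "nat \<Rightarrow> complex"
  obtains x where "(\<Sum>j<n. (cmod (x j))\<^sup>2) \<le> 1"
    "(\<Sum>j<n. z j * x j) = complex_of_real (sqrt (\<Sum>j<n. (cmod (z j))\<^sup>2))"
proof -
  define s where "s = (\<Sum>j<n. (cmod (z j))\<^sup>2)"
  have s0: "0 \<le> s" unfolding s_def by (intro sum_nonneg) auto
  have zz: "(\<Sum>j<n. z j * cnj (z j)) = complex_of_real s"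
    unfolding s_def by (simp only: of_real_sum complex_norm_square)
  show thesis
  proof (cases "s = 0")
    case True
    hence "\<forall>j<n. z j = 0" unfolding s_def by (subst (asm) sum_nonneg_eq_0_iff) auto
    thus thesis using True by (intro that[of "\<lambda>_. 0"]) (auto simp: s_def)
  next
    case False
    define x where "x = (\<lambda>j. cnj (z j) / complex_of_real (sqrt s))"
    have "(\<Sum>j<n. (cmod (x j))\<^sup>2) = (\<Sum>j<n. (cmod (z j))\<^sup>2) / s"
      using s0 by (simp add: x_def norm_divide power_divide sum_divide_distrib)
    hence 1: "(\<Sum>j<n. (cmod (x j))\<^sup>2) \<le> 1" using False by (simp add: s_def[symmetric])
    have "(\<Sum>j<n. z j * x j) = complex_of_real s / complex_of_real (sqrt s)"
      unfolding x_def zz[symmetric] by (simp add: sum_divide_distrib)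
    also have "\<dots> = complex_of_real (sqrt s)"
      using s0 by (simp add: of_real_divide[symmetric] real_div_sqrt del: of_real_divide)
    finally show thesis using 1 by (intro that[of x]) (auto simp: s_def)
  qed
qed

text \<open>With \<open>M\<close> the coefficient matrix of \<open>w\<close> and \<open>y = M x\<close>, Bob's operator \<open>K\<close> maps the
  row vector \<open>z = y\<^sup>* M\<close> to \<open>Z K\<close>; the new trial vector is the normalised conjugate of \<open>Z K\<close>.\<close>

lemma bob_overlap:
  assumes I: "instrument dB ops" and w: "w \<in> carrier_vec (dA * dB)"
    and x: "(\<Sum>j<dB. (cmod (x j))\<^sup>2) \<le> 1"
  obtains X where "\<And>K. (\<Sum>j<dim_row K. (cmod (X K j))\<^sup>2) \<le> 1"
    "overlap dA dB w x
      \<le> (\<Sum>K\<leftarrow>concat (map snd ops). overlap dA (dim_row K) (tensor_mat (1\<^sub>m dA) K *\<^sub>v w) (X K))"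
proof -
  define y where "y = (\<lambda>i. \<Sum>j<dB. w $ (i * dB + j) * x j)"
  define z where "z = (\<lambda>l. \<Sum>i<dA. cnj (y i) * w $ (i * dB + l))"
  define N where "N = overlap dA dB w x"
  define Z where "Z = (\<lambda>K :: complex mat. \<lambda>j. \<Sum>l<dB. K $$ (j, l) * z l)"
  define Ks where "Ks = concat (map snd ops)"
  have N0: "0 \<le> N" unfolding N_def by (rule overlap_nonneg)
  have Ny: "N = (\<Sum>i<dA. (cmod (y i))\<^sup>2)" unfolding N_def overlap_def y_def ..
  have "\<forall>K. \<exists>x. (\<Sum>j<dim_row K. (cmod (x j))\<^sup>2) \<le> 1 \<and>
      (\<Sum>j<dim_row K. Z K j * x j) = complex_of_real (sqrt (\<Sum>j<dim_row K. (cmod (Z K j))\<^sup>2))"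
    by (blast intro: normalized_conjugate_witness)
  from choice[OF this] obtain X where X: "\<And>K. (\<Sum>j<dim_row K. (cmod (X K j))\<^sup>2) \<le> 1"
    "\<And>K. (\<Sum>j<dim_row K. Z K j * X K j) = complex_of_real (sqrt (\<Sum>j<dim_row K. (cmod (Z K j))\<^sup>2))"
    by blast
  \<comment> \<open>Pairing \<open>Z K\<close> with \<open>X K\<close> attains the norm of
    \<open>Z K\<close>. The same pairing equals that of the conjugate of \<open>y\<close> with the
    new coefficient matrix applied to \<open>X K\<close>, and Cauchy-Schwarz splits off
    \<open>N\<close>, the squared norm of \<open>y\<close>.\<close>
  have step: "(\<Sum>j<dim_row K. (cmod (Z K j))\<^sup>2)
      \<le> N * overlap dA (dim_row K) (tensor_mat (1\<^sub>m dA) K *\<^sub>v w) (X K)" if "K \<in> set Ks" for K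
  proof -
    have K: "K \<in> carrier_mat (dim_row K) dB"
      using that unfolding Ks_def by (rule instrument_carrier[OF I])
    let ?w = "tensor_mat (1\<^sub>m dA) K *\<^sub>v w"
    have Zw: "Z K j = (\<Sum>i<dA. cnj (y i) * ?w $ (i * dim_row K + j))" if "j < dim_row K" for j
    proof -
      have "Z K j = (\<Sum>l<dB. \<Sum>i<dA. cnj (y i) * (K $$ (j, l) * w $ (i * dB + l)))"
        unfolding Z_def z_def by (simp add: sum_distrib_left mult_ac)
      also have "\<dots> = (\<Sum>i<dA. \<Sum>l<dB. cnj (y i) * (K $$ (j, l) * w $ (i * dB + l)))"
        by (rule sum.swap)
      also have "\<dots> = (\<Sum>i<dA. cnj (y i) * ?w $ (i * dim_row K + j))"
        using that by (simp add: index_tensor_right[OF K w] sum_distrib_left)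
      finally show ?thesis .
    qed
    have "(\<Sum>j<dim_row K. Z K j * X K j)
        = (\<Sum>j<dim_row K. \<Sum>i<dA. cnj (y i) * (?w $ (i * dim_row K + j) * X K j))"
      by (intro sum.cong refl) (simp add: Zw sum_distrib_right mult.assoc)
    also have "\<dots> = (\<Sum>i<dA. \<Sum>j<dim_row K. cnj (y i) * (?w $ (i * dim_row K + j) * X K j))"
      by (rule sum.swap)
    also have "\<dots> = (\<Sum>i<dA. cnj (y i) * (\<Sum>j<dim_row K. ?w $ (i * dim_row K + j) * X K j))"
      by (simp only: sum_distrib_left)
    finally have e: "(\<Sum>j<dim_row K. Z K j * X K j)
      = (\<Sum>i<dA. cnj (y i) * (\<Sum>j<dim_row K. ?w $ (i * dim_row K + j) * X K j))" .
    have "(\<Sum>j<dim_row K. (cmod (Z K j))\<^sup>2) = (cmod (\<Sum>j<dim_row K. Z K j * X K j))\<^sup>2"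
      unfolding X(2) by (simp add: sum_nonneg)
    also have "\<dots> \<le> (\<Sum>i<dA. (cmod (cnj (y i)))\<^sup>2)
        * (\<Sum>i<dA. (cmod (\<Sum>j<dim_row K. ?w $ (i * dim_row K + j) * X K j))\<^sup>2)"
      unfolding e by (rule Cauchy_Schwarz_complex_sum)
    also have "\<dots> = N * overlap dA (dim_row K) ?w (X K)" by (simp add: Ny overlap_def)
    finally show ?thesis .
  qed
  \<comment> \<open>\<open>z\<close> is the adjoint of \<open>y\<close> times \<open>M\<close>, and
    \<open>M x = y\<close>, so the pairing with \<open>x\<close> returns the squared norm of
    \<open>y\<close>. The old trial vector thus shows that the squared norm of \<open>z\<close> is
    at least \<open>N\<^sup>2\<close>.\<close>
  have zx: "(\<Sum>l<dB. z l * x l) = complex_of_real N"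
  proof -
    have "(\<Sum>l<dB. z l * x l) = (\<Sum>l<dB. \<Sum>i<dA. cnj (y i) * (w $ (i * dB + l) * x l))"
      unfolding z_def by (simp add: sum_distrib_right mult.assoc)
    also have "\<dots> = (\<Sum>i<dA. \<Sum>l<dB. cnj (y i) * (w $ (i * dB + l) * x l))" by (rule sum.swap)
    also have "\<dots> = (\<Sum>i<dA. y i * cnj (y i))"
      by (simp only: sum_distrib_left[symmetric]) (simp add: y_def mult.commute)
    also have "\<dots> = complex_of_real N" unfolding Ny by (simp only: of_real_sum complex_norm_square)
    finally show ?thesis .
  qed
  have "N\<^sup>2 = (cmod (\<Sum>l<dB. z l * x l))\<^sup>2" unfolding zx by simp
  also have "\<dots> \<le> (\<Sum>l<dB. (cmod (z l))\<^sup>2) * (\<Sum>l<dB. (cmod (x l))\<^sup>2)"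
    by (rule Cauchy_Schwarz_complex_sum)
  also have "\<dots> \<le> (\<Sum>l<dB. (cmod (z l))\<^sup>2)"
    using x by (intro mult_left_le sum_nonneg) auto
  also have "\<dots> = (\<Sum>K\<leftarrow>Ks. \<Sum>j<dim_row K. (cmod (Z K j))\<^sup>2)"
    unfolding Ks_def Z_def by (rule instrument_norm[OF I, symmetric])
  also have "\<dots> \<le> (\<Sum>K\<leftarrow>Ks. N * overlap dA (dim_row K) (tensor_mat (1\<^sub>m dA) K *\<^sub>v w) (X K))"
    by (rule sum_list_mono) (rule step)
  also have "\<dots> = N * (\<Sum>K\<leftarrow>Ks. overlap dA (dim_row K) (tensor_mat (1\<^sub>m dA) K *\<^sub>v w) (X K))"
    by (rule sum_list_const_mult)
  finally have main: "N * N \<le> N * (\<Sum>K\<leftarrow>Ks. overlap dA (dim_row K) (tensor_mat (1\<^sub>m dA) K *\<^sub>v w) (X K))"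
    by (simp add: power2_eq_square)
  have "N \<le> (\<Sum>K\<leftarrow>Ks. overlap dA (dim_row K) (tensor_mat (1\<^sub>m dA) K *\<^sub>v w) (X K))"
  proof (cases "N = 0")
    case True
    show ?thesis unfolding True by (intro sum_list_nonneg) (auto intro: overlap_nonneg)
  next
    case False
    thus ?thesis using N0 main by (simp add: mult_le_cancel_left)
  qed
  thus thesis using X(1) unfolding N_def Ks_def by (intro that)
qed

text \<open>The Bell state is pure, so a mixture reduces to it only if every nonzero member does.
  Positivity gives this directly: for each of the three amplitudes or differences claimed to vanish,
  the squared moduli, summed over the whole list and all leftover indices, form a combination of
  entries of the reduced state that is 0.\<close>

lemma bell_amplitudes:
  assumes ws: "\<forall>w\<in>set ws. w \<in> carrier_vec ((2 * rA) * (2 * rB))"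
    and tr: "mat_trace (ensemble ((2 * rA) * (2 * rB)) ws) \<noteq> 0"
    and bell: "reduced_AB rA rB ((1 / mat_trace (ensemble ((2 * rA) * (2 * rB)) ws))
      \<cdot>\<^sub>m ensemble ((2 * rA) * (2 * rB)) ws) = projector bell_state"
    and w: "w \<in> set ws" and xy: "x < rA" "y < rB"
  shows "w $ (x * (2 * rB) + (rB + y)) = 0" "w $ ((rA + x) * (2 * rB) + y) = 0"
    "w $ ((rA + x) * (2 * rB) + (rB + y)) = w $ (x * (2 * rB) + y)"
proof -
  define n where "n = (2 * rA) * (2 * rB)"
  define T where "T = mat_trace (ensemble n ws)"
  define pos where "pos = (\<lambda>i x y. ((i div 2) * rA + x) * (2 * rB) + ((i mod 2) * rB + y))"
  define G where "G = (\<lambda>i j. \<Sum>x<rA. \<Sum>y<rB. \<Sum>w\<leftarrow>ws. w $ pos i x y * cnj (w $ pos j x y))"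
  have T0: "T \<noteq> 0" using tr by (simp add: T_def n_def)
  have ws': "\<forall>w\<in>set ws. w \<in> carrier_vec n" using ws by (simp add: n_def)
  have posn: "pos i x y < n" if "i < 4" "x < rA" "y < rB" for i x y
  proof -
    have "i div 2 < 2" "i mod 2 < 2" using that by auto
    hence "i div 2 * rA + x < 2 * rA" "i mod 2 * rB + y < 2 * rB"
      using that by (auto intro: prod_index_less)
    thus ?thesis unfolding pos_def n_def by (rule prod_index_less)
  qed
  have G: "G i j = T * projector bell_state $$ (i, j)" if ij: "i < 4" "j < 4" for i j
  proof -
    note E = ensemble_carrier[OF ws']
    have "projector bell_state $$ (i, j)
        = (\<Sum>x<rA. \<Sum>y<rB. ((1 / T) \<cdot>\<^sub>m ensemble n ws) $$ (pos i x y, pos j x y))"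
      using ij unfolding bell[symmetric] reduced_AB_def n_def[symmetric] T_def[symmetric]
      by (simp add: Let_def pos_def)
    also have "\<dots> = (\<Sum>x<rA. \<Sum>y<rB. (1 / T) * (\<Sum>w\<leftarrow>ws. w $ pos i x y * cnj (w $ pos j x y)))"
    proof (intro sum.cong refl)
      fix x y assume "x \<in> {..<rA}" "y \<in> {..<rB}"
      hence p: "pos i x y < n" "pos j x y < n" using posn ij by auto
      thus "((1 / T) \<cdot>\<^sub>m ensemble n ws) $$ (pos i x y, pos j x y)
          = (1 / T) * (\<Sum>w\<leftarrow>ws. w $ pos i x y * cnj (w $ pos j x y))"
        using carrier_matD[OF E] by (simp add: index_ensemble[OF ws' p])
    qed
    also have "\<dots> = (1 / T) * G i j" unfolding G_def by (simp only: sum_distrib_left)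
    finally show ?thesis using T0 by simp
  qed
  have P: "projector bell_state $$ (i, j) = (if i \<in> {0, 3} \<and> j \<in> {0, 3} then 1 / 2 else 0)"
    if "i < 4" "j < 4" for i j
  proof -
    have h: "complex_of_real (1 / sqrt 2) * complex_of_real (1 / sqrt 2) = 1 / 2"
      by (simp only: of_real_mult[symmetric]) simp
    have "i \<in> {0, 1, 2, 3}" "j \<in> {0, 1, 2, 3}" using that by auto
    thus ?thesis
      unfolding projector_def bell_state_def using h
      by (auto simp: vec_of_list_index numeral_2_eq_2 numeral_3_eq_3)
  qed
  have zero: "h w x y = 0" if "(\<Sum>x<rA. \<Sum>y<rB. \<Sum>w\<leftarrow>ws. h w x y * cnj (h w x y)) = 0"
    for h :: "complex vec \<Rightarrow> nat \<Rightarrow> nat \<Rightarrow> complex"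
  proof -
    have "complex_of_real (\<Sum>x<rA. \<Sum>y<rB. \<Sum>w\<leftarrow>ws. (cmod (h w x y))\<^sup>2) = 0"
      unfolding of_real_sum of_real_sum_list_map complex_norm_square by (rule that)
    hence "(\<Sum>x<rA. \<Sum>y<rB. \<Sum>w\<leftarrow>ws. (cmod (h w x y))\<^sup>2) = 0" by (simp only: of_real_eq_0_iff)
    hence "(\<Sum>y<rB. \<Sum>w\<leftarrow>ws. (cmod (h w x y))\<^sup>2) = 0"
      using xy by (subst (asm) sum_nonneg_eq_0_iff) (auto intro!: sum_nonneg sum_list_nonneg)
    hence "(\<Sum>w\<leftarrow>ws. (cmod (h w x y))\<^sup>2) = 0"
      using xy by (subst (asm) sum_nonneg_eq_0_iff) (auto intro!: sum_list_nonneg)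
    hence "(cmod (h w x y))\<^sup>2 = 0"
      using w by (subst (asm) sum_list_nonneg_eq_0_iff) auto
    thus ?thesis by simp
  qed
  have p: "pos 0 x y = x * (2 * rB) + y" "pos 1 x y = x * (2 * rB) + (rB + y)"
    "pos 2 x y = (rA + x) * (2 * rB) + y" "pos 3 x y = (rA + x) * (2 * rB) + (rB + y)"
    unfolding pos_def by (simp_all add: mod2_eq_if)
  have "G 1 1 = 0" "G 2 2 = 0" by (simp_all add: G P)
  thus "w $ (x * (2 * rB) + (rB + y)) = 0" "w $ ((rA + x) * (2 * rB) + y) = 0"
    unfolding p[symmetric] G_def
    by (intro zero[of "\<lambda>w x y. w $ pos 1 x y"] zero[of "\<lambda>w x y. w $ pos 2 x y"]; simp)+
  \<comment> \<open>Up to normalisation this is the weight of the reduced state along |11> - |00>,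
    which is orthogonal to the Bell state.\<close>
  have "(\<Sum>x<rA. \<Sum>y<rB. \<Sum>w\<leftarrow>ws. (w $ pos 3 x y - w $ pos 0 x y) * cnj (w $ pos 3 x y - w $ pos 0 x y))
      = G 3 3 - G 3 0 - G 0 3 + G 0 0"
    unfolding G_def
    by (simp add: algebra_simps sum.distrib sum_subtractf sum_list_addf sum_list_subtractf)
  also have "\<dots> = 0" by (simp add: G P)
  finally have "w $ pos 3 x y - w $ pos 0 x y = 0" by (rule zero)
  thus "w $ ((rA + x) * (2 * rB) + (rB + y)) = w $ (x * (2 * rB) + y)"
    unfolding p by simp
qed

text \<open>By \<open>bell_amplitudes\<close> the coefficient matrix is block diagonal with two
  copies of \<open>R\<close>. Both halves of \<open>X\<close> are estimated by the Frobenius norm of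
  \<open>R\<close>; as its square \<open>F\<close> is half of \<open>norm_sq w\<close>, this crude
  estimate already yields the factor 2.\<close>

lemma bell_overlap:
  assumes ws: "\<forall>w\<in>set ws. w \<in> carrier_vec (dA * dB)"
    and bell: "bell_outcome (dA, dB, ensemble (dA * dB) ws)"
    and w: "w \<in> set ws" and X: "(\<Sum>j<dB. (cmod (X j))\<^sup>2) \<le> 1"
  shows "2 * overlap dA dB w X \<le> norm_sq w"
proof -
  from bell obtain rA rB where d: "dA = 2 * rA" "dB = 2 * rB"
    and tr: "mat_trace (ensemble (dA * dB) ws) \<noteq> 0"
    and red: "reduced_AB rA rB ((1 / mat_trace (ensemble (dA * dB) ws)) \<cdot>\<^sub>m ensemble (dA * dB) ws)
      = projector bell_state"
    by auto
  note amp = bell_amplitudes[OF ws[unfolded d] tr[unfolded d] red[unfolded d] w]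
  define R where "R = (\<lambda>x y. w $ (x * (2 * rB) + y))"
  define F where "F = (\<Sum>x<rA. \<Sum>y<rB. (cmod (R x y))\<^sup>2)"
  have two: "(\<Sum>q<2. f q) = f 0 + f 1" for f :: "nat \<Rightarrow> 'b::comm_monoid_add"
    by (simp add: numeral_2_eq_2)
  have wc: "w \<in> carrier_vec ((2 * rA) * (2 * rB))" using ws w d by auto
  have norm: "norm_sq w = 2 * F"
    unfolding norm_sq_bipartite[OF wc] sum_lessThan_mult two
    by (simp add: F_def R_def amp)
  have "overlap dA dB w X = (\<Sum>x<rA. (cmod (\<Sum>y<rB. R x y * X y))\<^sup>2)
      + (\<Sum>x<rA. (cmod (\<Sum>y<rB. R x y * X (rB + y)))\<^sup>2)"
    unfolding overlap_def d sum_lessThan_mult two by (simp add: R_def amp)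
  also have "\<dots> \<le> (\<Sum>x<rA. (\<Sum>y<rB. (cmod (R x y))\<^sup>2) * (\<Sum>y<rB. (cmod (X y))\<^sup>2))
      + (\<Sum>x<rA. (\<Sum>y<rB. (cmod (R x y))\<^sup>2) * (\<Sum>y<rB. (cmod (X (rB + y)))\<^sup>2))"
    by (intro add_mono sum_mono Cauchy_Schwarz_complex_sum)
  also have "\<dots> = F * (\<Sum>j<dB. (cmod (X j))\<^sup>2)"
    unfolding d sum_lessThan_mult two F_def by (simp add: sum_distrib_right distrib_left)
  also have "\<dots> \<le> F" using X unfolding F_def by (intro mult_left_le sum_nonneg) auto
  finally show ?thesis using norm by simp
qed

section \<open>Induction over protocols\<close>

lemma overlap_le_norm_sq:
  assumes w: "w \<in> carrier_vec (dA * dB)" and x: "(\<Sum>j<dB. (cmod (x j))\<^sup>2) \<le> 1"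
  shows "overlap dA dB w x \<le> norm_sq w"
proof -
  have "overlap dA dB w x \<le> (\<Sum>i<dA. (\<Sum>j<dB. (cmod (w $ (i * dB + j)))\<^sup>2) * (\<Sum>j<dB. (cmod (x j))\<^sup>2))"
    unfolding overlap_def by (intro sum_mono Cauchy_Schwarz_complex_sum)
  also have "\<dots> \<le> (\<Sum>i<dA. \<Sum>j<dB. (cmod (w $ (i * dB + j)))\<^sup>2)"
    using x by (intro sum_mono mult_left_le sum_nonneg) auto
  finally show ?thesis unfolding norm_sq_bipartite[OF w] .
qed

text \<open>Completeness sums run over the flattened list of Kraus operators, in which the branch
  dimension \<open>d\<close> survives only as \<open>dim_row K\<close>.\<close>

lemma sum_list_branches:
  fixes h :: "nat \<Rightarrow> complex mat \<Rightarrow> real"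
  assumes "instrument n (map (\<lambda>(d, Ks, P). (d, Ks)) bs)"
  shows "(\<Sum>(d, Ks, P)\<leftarrow>bs. \<Sum>K\<leftarrow>Ks. h d K)
    = (\<Sum>K\<leftarrow>concat (map snd (map (\<lambda>(d, Ks, P). (d, Ks)) bs)). h (dim_row K) K)"
proof -
  have "(case b of (d, Ks, P) \<Rightarrow> \<Sum>K\<leftarrow>Ks. h d K)
      = (\<Sum>K\<leftarrow>snd (case b of (d, Ks, P) \<Rightarrow> (d, Ks)). h (dim_row K) K)" if b: "b \<in> set bs" for b
  proof -
    obtain d Ks P where b': "b = (d, Ks, P)" by (cases b) auto
    have "(d, Ks) \<in> set (map (\<lambda>(d, Ks, P). (d, Ks)) bs)"
      using b unfolding b' by force
    hence "\<forall>K\<in>set Ks. K \<in> carrier_mat d n" using assms unfolding instrument_def by blast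
    hence "\<forall>K\<in>set Ks. dim_row K = d" by auto
    thus ?thesis unfolding b' by (simp cong: map_cong)
  qed
  thus ?thesis
    unfolding sum_list_concat_map map_map o_def
    by (intro arg_cong[where f = sum_list] map_cong refl)
qed

text \<open>A potential that bounds the success probability still reachable from \<open>w\<close>.
  Its total is preserved by Alice, does not grow under Bob for suitable new trial vectors when
  \<open>0 \<le> \<beta>\<close>, and dominates the success probability at the end under the
  conditions of \<open>bell_probability_Finish\<close>.\<close>

definition gain :: "real \<Rightarrow> real \<Rightarrow> nat \<Rightarrow> nat \<Rightarrow> complex vec \<times> (nat \<Rightarrow> complex) \<Rightarrow> real" where
  "gain \<alpha> \<beta> dA dB = (\<lambda>(w, x). \<alpha> * norm_sq w - \<beta> * overlap dA dB w x)"

definition trial_pair :: "nat \<Rightarrow> nat \<Rightarrow> complex vec \<times> (nat \<Rightarrow> complex) \<Rightarrow> bool" where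
  "trial_pair dA dB = (\<lambda>(w, x). w \<in> carrier_vec (dA * dB) \<and> (\<Sum>j<dB. (cmod (x j))\<^sup>2) \<le> 1)"

text \<open>\<open>\<beta> \<le> \<alpha>\<close> keeps the gain of a failed outcome nonnegative.
  \<open>\<beta> \<le> 2 * (\<alpha> - 1)\<close> makes the gain of each vector in a Bell outcome at
  least its squared norm, because there the overlap is at most half of it.\<close>

lemma bell_probability_Finish:
  assumes \<alpha>\<beta>: "0 \<le> \<beta>" "\<beta> \<le> \<alpha>" "\<beta> \<le> 2 * (\<alpha> - 1)"
    and wxs: "\<forall>p\<in>set wxs. trial_pair dA dB p"
  shows "final_bell_probability [(dA, dB, ensemble (dA * dB) (map fst wxs))]
    \<le> (\<Sum>p\<leftarrow>wxs. gain \<alpha> \<beta> dA dB p)"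
proof (cases "bell_outcome (dA, dB, ensemble (dA * dB) (map fst wxs))")
  case False
  have "0 \<le> gain \<alpha> \<beta> dA dB p" if "p \<in> set wxs" for p
  proof -
    obtain w x where p: "p = (w, x)" by (cases p) auto
    have "overlap dA dB w x \<le> norm_sq w"
      using wxs that unfolding p by (intro overlap_le_norm_sq) (auto simp: trial_pair_def)
    hence "\<beta> * overlap dA dB w x \<le> \<alpha> * norm_sq w"
      using \<alpha>\<beta> by (intro mult_mono overlap_nonneg) auto
    thus ?thesis by (simp add: p gain_def)
  qed
  thus ?thesis using False
    by (auto simp: final_bell_probability_def intro!: sum_list_nonneg simp del: bell_outcome.simps)
next
  case True
  have ws: "\<forall>w\<in>set (map fst wxs). w \<in> carrier_vec (dA * dB)"
    using wxs by (auto simp: trial_pair_def)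
  have "norm_sq (fst p) \<le> gain \<alpha> \<beta> dA dB p" if "p \<in> set wxs" for p
  proof -
    obtain w x where p: "p = (w, x)" by (cases p) auto
    have "2 * overlap dA dB w x \<le> norm_sq w"
    proof (rule bell_overlap[OF ws True])
      show "w \<in> set (map fst wxs)" using that unfolding p by force
      show "(\<Sum>j<dB. (cmod (x j))\<^sup>2) \<le> 1"
        using wxs that unfolding p by (auto simp: trial_pair_def)
    qed
    hence "\<beta> * (2 * overlap dA dB w x) \<le> 2 * (\<alpha> - 1) * norm_sq w"
      using \<alpha>\<beta> by (intro mult_mono) (auto simp: overlap_nonneg)
    thus ?thesis by (simp add: p gain_def algebra_simps)
  qed
  moreover have "final_bell_probability [(dA, dB, ensemble (dA * dB) (map fst wxs))]
      = (\<Sum>p\<leftarrow>wxs. norm_sq (fst p))"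
    using True unfolding final_bell_probability_def
    by (simp add: mat_trace_ensemble[OF ws] o_def del: bell_outcome.simps)
  ultimately show ?thesis by (simp add: sum_list_mono)
qed

lemma alice_gain:
  assumes I: "instrument dA ops" and p: "trial_pair dA dB (w, x)"
  shows "(\<Sum>K\<leftarrow>concat (map snd ops). gain \<alpha> \<beta> (dim_row K) dB (tensor_mat K (1\<^sub>m dB) *\<^sub>v w, x))
    = gain \<alpha> \<beta> dA dB (w, x)"
proof -
  have w: "w \<in> carrier_vec (dA * dB)" using p by (simp add: trial_pair_def)
  show ?thesis
    unfolding gain_def split_conv sum_list_subtractf sum_list_const_mult
      alice_norm[OF I w] alice_overlap[OF I w] ..
qed

lemma bob_gain:
  assumes \<beta>: "0 \<le> \<beta>" and I: "instrument dB ops" and p: "trial_pair dA dB (w, x)"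
  shows "\<exists>X. (\<forall>K. (\<Sum>j<dim_row K. (cmod (X K j))\<^sup>2) \<le> 1) \<and>
    (\<Sum>K\<leftarrow>concat (map snd ops). gain \<alpha> \<beta> dA (dim_row K) (tensor_mat (1\<^sub>m dA) K *\<^sub>v w, X K))
      \<le> gain \<alpha> \<beta> dA dB (w, x)"
proof -
  have w: "w \<in> carrier_vec (dA * dB)" and x: "(\<Sum>j<dB. (cmod (x j))\<^sup>2) \<le> 1"
    using p by (auto simp: trial_pair_def)
  from bob_overlap[OF I w x] obtain X where X: "\<And>K. (\<Sum>j<dim_row K. (cmod (X K j))\<^sup>2) \<le> 1"
    "overlap dA dB w x
      \<le> (\<Sum>K\<leftarrow>concat (map snd ops). overlap dA (dim_row K) (tensor_mat (1\<^sub>m dA) K *\<^sub>v w) (X K))"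
    by blast
  have "(\<Sum>K\<leftarrow>concat (map snd ops). gain \<alpha> \<beta> dA (dim_row K) (tensor_mat (1\<^sub>m dA) K *\<^sub>v w, X K))
      \<le> gain \<alpha> \<beta> dA dB (w, x)"
    unfolding gain_def split_conv sum_list_subtractf sum_list_const_mult bob_norm[OF I w]
    using mult_left_mono[OF X(2) \<beta>] by simp
  thus ?thesis using X(1) by blast
qed

text \<open>Each image vector carries a trial vector along. \<open>T\<close> embeds a local operator
  into the joint space; \<open>X p K\<close> is \<open>snd p\<close> for Alice and the vector
  supplied by \<open>bob_gain\<close> for Bob.\<close>

lemma operation_trial_list:
  assumes "\<forall>K\<in>set Ks. T K \<in> carrier_mat n m" "\<forall>p\<in>set wxs. fst p \<in> carrier_vec m"
  shows "operation n (map T Ks) (ensemble m (map fst wxs))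
    = ensemble n (map fst (concat (map (\<lambda>K. map (\<lambda>p. (T K *\<^sub>v fst p, X p K)) wxs) Ks)))"
proof -
  have "operation n (map T Ks) (ensemble m (map fst wxs))
      = ensemble n (concat (map (\<lambda>K. map (\<lambda>w. K *\<^sub>v w) (map fst wxs)) (map T Ks)))"
    using assms by (intro operation_ensemble) auto
  also have "concat (map (\<lambda>K. map (\<lambda>w. K *\<^sub>v w) (map fst wxs)) (map T Ks))
      = map fst (concat (map (\<lambda>K. map (\<lambda>p. (T K *\<^sub>v fst p, X p K)) wxs) Ks))"
    by (simp add: map_concat o_def)
  finally show ?thesis .
qed

text \<open>The parameters \<open>(\<alpha>, \<beta>) = (1, 0)\<close> and \<open>(2, 2)\<close> give the bounds \<open>1\<close> and
  \<open>2 * (1 - lambda_max)\<close>; the overlap of \<open>w\<close> with the trial vector \<open>x\<close> is a lower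
  bound for the largest squared Schmidt coefficient of \<open>w\<close>.\<close>

lemma final_bell_probability_bound:
  assumes \<alpha>\<beta>: "0 \<le> \<beta>" "\<beta> \<le> \<alpha>" "\<beta> \<le> 2 * (\<alpha> - 1)"
  shows "locc_protocol dA dB P \<Longrightarrow> \<forall>p\<in>set wxs. trial_pair dA dB p \<Longrightarrow>
    final_bell_probability (outcomes dA dB (ensemble (dA * dB) (map fst wxs)) P)
      \<le> (\<Sum>p\<leftarrow>wxs. gain \<alpha> \<beta> dA dB p)"
proof (induction dA dB P arbitrary: wxs rule: locc_protocol.induct)
  case (1 dA dB)
  thus ?case using bell_probability_Finish[OF \<alpha>\<beta>] by simp
next
  case (2 dA dB bs)
  let ?ops = "map (\<lambda>(d, Ks, P). (d, Ks)) bs"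
  let ?T = "\<lambda>K. tensor_mat K (1\<^sub>m dB)"
  let ?\<rho> = "ensemble (dA * dB) (map fst wxs)"
  let ?h = "\<lambda>d K. \<Sum>p\<leftarrow>wxs. gain \<alpha> \<beta> d dB (?T K *\<^sub>v fst p, snd p)"
  from 2(2) have I: "instrument dA ?ops" by simp
  have branch: "final_bell_probability (case b of (d, Ks, P) \<Rightarrow>
        outcomes d dB (operation (d * dB) (map ?T Ks) ?\<rho>) P)
      \<le> (case b of (d, Ks, P) \<Rightarrow> \<Sum>K\<leftarrow>Ks. ?h d K)" if b: "b \<in> set bs" for b
  proof -
    obtain d Ks P where b': "b = (d, Ks, P)" by (cases b) auto
    have "(d, Ks) \<in> set ?ops" using b unfolding b' by force
    hence K: "\<forall>K\<in>set Ks. K \<in> carrier_mat d dA" using I unfolding instrument_def by blast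
    hence T: "\<forall>K\<in>set Ks. ?T K \<in> carrier_mat (d * dB) (dA * dB)" by auto
    have w: "\<forall>p\<in>set wxs. fst p \<in> carrier_vec (dA * dB)" using 2(3) by (auto simp: trial_pair_def)
    \<comment> \<open>Several Kraus operators in one branch lengthen the list of vectors, which is
      why the induction is over arbitrary \<open>wxs\<close>.\<close>
    let ?l = "concat (map (\<lambda>K. map (\<lambda>p. (?T K *\<^sub>v fst p, snd p)) wxs) Ks)"
    have l: "\<forall>p\<in>set ?l. trial_pair d dB p"
    proof
      fix q assume "q \<in> set ?l"
      then obtain K p where Kp: "K \<in> set Ks" "p \<in> set wxs" "q = (?T K *\<^sub>v fst p, snd p)" by auto
      have "?T K *\<^sub>v fst p \<in> carrier_vec (d * dB)"
        using Kp T w by (intro mult_mat_vec_carrier[where n = "dA * dB"]) auto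
      thus "trial_pair d dB q" using Kp 2(3) by (auto simp: trial_pair_def)
    qed
    have "locc_protocol d dB P" using 2(2) b unfolding b' by auto
    from 2(1)[OF b b'[symmetric] refl this l]
    have "final_bell_probability (outcomes d dB (ensemble (d * dB) (map fst ?l)) P)
        \<le> (\<Sum>p\<leftarrow>?l. gain \<alpha> \<beta> d dB p)" .
    thus ?thesis
      unfolding b' by (simp add: operation_trial_list[OF T w, where X = "\<lambda>p K. snd p"] sum_list_concat_map o_def)
  qed
  have "final_bell_probability (outcomes dA dB ?\<rho> (Alice bs))
      = (\<Sum>b\<leftarrow>bs. final_bell_probability (case b of (d, Ks, P) \<Rightarrow>
        outcomes d dB (operation (d * dB) (map ?T Ks) ?\<rho>) P))"
    by (simp add: final_bell_probability_concat o_def)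
  also have "\<dots> \<le> (\<Sum>(d, Ks, P)\<leftarrow>bs. \<Sum>K\<leftarrow>Ks. ?h d K)"
    by (rule sum_list_mono) (rule branch)
  also have "\<dots> = (\<Sum>p\<leftarrow>wxs. \<Sum>K\<leftarrow>concat (map snd ?ops). gain \<alpha> \<beta> (dim_row K) dB (?T K *\<^sub>v fst p, snd p))"
    unfolding sum_list_branches[OF I] by (rule sum_list_swap)
  also have "\<dots> = (\<Sum>p\<leftarrow>wxs. gain \<alpha> \<beta> dA dB p)"
  proof (intro arg_cong[where f = sum_list] map_cong refl)
    fix p assume "p \<in> set wxs"
    hence "trial_pair dA dB (fst p, snd p)" using 2(3) by simp
    from alice_gain[OF I this]
    show "(\<Sum>K\<leftarrow>concat (map snd ?ops). gain \<alpha> \<beta> (dim_row K) dB (?T K *\<^sub>v fst p, snd p))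
        = gain \<alpha> \<beta> dA dB p" by simp
  qed
  finally show ?case .
next
  case (3 dA dB bs)
  let ?ops = "map (\<lambda>(d, Ks, P). (d, Ks)) bs"
  let ?T = "\<lambda>K. tensor_mat (1\<^sub>m dA) K"
  let ?\<rho> = "ensemble (dA * dB) (map fst wxs)"
  from 3(2) have I: "instrument dB ?ops" by simp
  \<comment> \<open>The new trial vectors are fixed for all members of the list before any branch is
    entered. The implication makes the statement total in \<open>p\<close>, as \<open>choice\<close>
    requires.\<close>
  have "\<forall>p. \<exists>X. p \<in> set wxs \<longrightarrow> (\<forall>K. (\<Sum>j<dim_row K. (cmod (X K j))\<^sup>2) \<le> 1) \<and>
      (\<Sum>K\<leftarrow>concat (map snd ?ops). gain \<alpha> \<beta> dA (dim_row K) (?T K *\<^sub>v fst p, X K)) \<le> gain \<alpha> \<beta> dA dB p"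
    (is "\<forall>p. \<exists>X. p \<in> set wxs \<longrightarrow> ?Q p X")
  proof (intro allI)
    fix p
    show "\<exists>X. p \<in> set wxs \<longrightarrow> ?Q p X"
    proof (cases "p \<in> set wxs")
      case True
      hence "trial_pair dA dB (fst p, snd p)" using 3(3) by simp
      from bob_gain[OF \<alpha>\<beta>(1) I this, of \<alpha>] have "\<exists>X. ?Q p X" by simp
      thus ?thesis by blast
    qed simp
  qed
  then obtain X where "\<forall>p. p \<in> set wxs \<longrightarrow> ?Q p (X p)" by (rule choice[THEN exE])
  hence X: "\<And>p K. p \<in> set wxs \<Longrightarrow> (\<Sum>j<dim_row K. (cmod (X p K j))\<^sup>2) \<le> 1"
    "\<And>p. p \<in> set wxs \<Longrightarrow> (\<Sum>K\<leftarrow>concat (map snd ?ops). gain \<alpha> \<beta> dA (dim_row K) (?T K *\<^sub>v fst p, X p K))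
      \<le> gain \<alpha> \<beta> dA dB p"
    by blast+
  let ?h = "\<lambda>d K. \<Sum>p\<leftarrow>wxs. gain \<alpha> \<beta> dA d (?T K *\<^sub>v fst p, X p K)"
  have branch: "final_bell_probability (case b of (d, Ks, P) \<Rightarrow>
        outcomes dA d (operation (dA * d) (map ?T Ks) ?\<rho>) P)
      \<le> (case b of (d, Ks, P) \<Rightarrow> \<Sum>K\<leftarrow>Ks. ?h d K)" if b: "b \<in> set bs" for b
  proof -
    obtain d Ks P where b': "b = (d, Ks, P)" by (cases b) auto
    have "(d, Ks) \<in> set ?ops" using b unfolding b' by force
    hence K: "\<forall>K\<in>set Ks. K \<in> carrier_mat d dB" using I unfolding instrument_def by blast
    hence T: "\<forall>K\<in>set Ks. ?T K \<in> carrier_mat (dA * d) (dA * dB)" by auto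
    have w: "\<forall>p\<in>set wxs. fst p \<in> carrier_vec (dA * dB)" using 3(3) by (auto simp: trial_pair_def)
    let ?l = "concat (map (\<lambda>K. map (\<lambda>p. (?T K *\<^sub>v fst p, X p K)) wxs) Ks)"
    have l: "\<forall>p\<in>set ?l. trial_pair dA d p"
    proof
      fix q assume "q \<in> set ?l"
      then obtain K' p where Kp: "K' \<in> set Ks" "p \<in> set wxs" "q = (?T K' *\<^sub>v fst p, X p K')" by auto
      have "?T K' *\<^sub>v fst p \<in> carrier_vec (dA * d)"
        using Kp T w by (intro mult_mat_vec_carrier[where n = "dA * dB"]) auto
      moreover have "dim_row K' = d" using K Kp(1) by auto
      ultimately show "trial_pair dA d q" using Kp X(1)[OF Kp(2), of K'] by (auto simp: trial_pair_def)
    qed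
    have "locc_protocol dA d P" using 3(2) b unfolding b' by auto
    from 3(1)[OF b b'[symmetric] refl this l]
    have "final_bell_probability (outcomes dA d (ensemble (dA * d) (map fst ?l)) P)
        \<le> (\<Sum>p\<leftarrow>?l. gain \<alpha> \<beta> dA d p)" .
    thus ?thesis
      unfolding b' by (simp add: operation_trial_list[OF T w, where X = X] sum_list_concat_map o_def)
  qed
  have "final_bell_probability (outcomes dA dB ?\<rho> (Bob bs))
      = (\<Sum>b\<leftarrow>bs. final_bell_probability (case b of (d, Ks, P) \<Rightarrow>
        outcomes dA d (operation (dA * d) (map ?T Ks) ?\<rho>) P))"
    by (simp add: final_bell_probability_concat o_def)
  also have "\<dots> \<le> (\<Sum>(d, Ks, P)\<leftarrow>bs. \<Sum>K\<leftarrow>Ks. ?h d K)"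
    by (rule sum_list_mono) (rule branch)
  also have "\<dots> = (\<Sum>p\<leftarrow>wxs. \<Sum>K\<leftarrow>concat (map snd ?ops). gain \<alpha> \<beta> dA (dim_row K) (?T K *\<^sub>v fst p, X p K))"
    unfolding sum_list_branches[OF I] by (rule sum_list_swap)
  also have "\<dots> \<le> (\<Sum>p\<leftarrow>wxs. gain \<alpha> \<beta> dA dB p)"
    by (rule sum_list_mono) (rule X(2))
  finally show ?case .
qed

lemma bell_probability_le:
  assumes P: "locc_protocol dA dB P" and v: "v \<in> carrier_vec (dA * dB)" "norm_sq v = 1"
  shows "bell_probability dA dB v P \<le> 1"
    and "(\<Sum>j<dB. (cmod (x j))\<^sup>2) \<le> 1 \<Longrightarrow> bell_probability dA dB v P \<le> 2 * (1 - overlap dA dB v x)"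
proof -
  have *: "bell_probability dA dB v P \<le> gain \<alpha> \<beta> dA dB (v, x)"
    if "0 \<le> \<beta>" "\<beta> \<le> \<alpha>" "\<beta> \<le> 2 * (\<alpha> - 1)" "(\<Sum>j<dB. (cmod (x j))\<^sup>2) \<le> 1" for \<alpha> \<beta> x
    using final_bell_probability_bound[OF that(1-3) P, of "[(v, x)]"] v that(4)
    by (simp add: trial_pair_def ensemble_singleton bell_probability_def final_bell_probability_def)
  \<comment> \<open>The first instantiated variable is \<open>\<beta>\<close>: here
    \<open>\<beta> = 0\<close> and \<open>\<alpha> = 1\<close>, so the zero trial vector will
    do.\<close>
  from *[of 0 1 "\<lambda>_. 0"] show "bell_probability dA dB v P \<le> 1"
    using v by (simp add: gain_def)
  show "bell_probability dA dB v P \<le> 2 * (1 - overlap dA dB v x)"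
    if "(\<Sum>j<dB. (cmod (x j))\<^sup>2) \<le> 1"
    using *[of 2 2 x] that v by (simp add: gain_def)
qed

section \<open>Schmidt decompositions\<close>

lemma mat_trace_mult_commute:
  assumes "X \<in> carrier_mat n n" "Y \<in> carrier_mat n n"
  shows "mat_trace (X * Y) = mat_trace (Y * X)"
proof -
  have "mat_trace (X * Y) = (\<Sum>i<n. \<Sum>l<n. X $$ (i, l) * Y $$ (l, i))"
    using assms by (simp add: mat_trace_def index_mult_mat_sum[OF assms] del: index_mult_mat(1))
  also have "\<dots> = (\<Sum>l<n. \<Sum>i<n. Y $$ (l, i) * X $$ (i, l))"
    by (subst sum.swap) (simp add: mult.commute)
  also have "\<dots> = mat_trace (Y * X)"
    using assms by (simp add: mat_trace_def index_mult_mat_sum[OF assms(2,1)] del: index_mult_mat(1))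
  finally show ?thesis .
qed

text \<open>The trace is the sum of the diagonal of a Schur form, whose entries are eigenvalues, and
  a nonzero sum has a nonzero term. This supplies one singular vector at a time in
  \<open>singular_system_extend\<close>.\<close>

lemma nonzero_eigenvalue_if_trace_nonzero:
  assumes A: "A \<in> carrier_mat n n" and tr: "mat_trace A \<noteq> 0"
  obtains \<mu> where "eigenvalue A \<mu>" "\<mu> \<noteq> 0"
proof -
  from char_poly_factorized[OF A] obtain es where "char_poly A = (\<Prod>a\<leftarrow>es. [:- a, 1:])" by auto
  from schur_decomposition_exists[OF A this] obtain B where B: "B \<in> carrier_mat n n"
    and ut: "upper_triangular B" and sim: "similar_mat A B" by auto
  from sim obtain P Q where wit: "similar_mat_wit A B P Q" unfolding similar_mat_def by auto
  from similar_mat_witD2[OF A wit] have PQ: "P \<in> carrier_mat n n" "Q \<in> carrier_mat n n"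
    and QP: "Q * P = 1\<^sub>m n" and AB: "A = P * B * Q" by auto
  have "mat_trace A = mat_trace (Q * (P * B))"
    unfolding AB using PQ B by (intro mat_trace_mult_commute) auto
  also have "Q * (P * B) = Q * P * B" by (rule assoc_mult_mat[OF PQ(2,1) B, symmetric])
  also have "\<dots> = B" using B by (simp add: QP)
  finally have "(\<Sum>i<n. B $$ (i, i)) \<noteq> 0" using tr B by (simp add: mat_trace_def)
  then obtain i where i: "i < n" "B $$ (i, i) \<noteq> 0" by (auto elim: sum.not_neutral_contains_not_neutral)
  have "char_poly A = char_poly B" by (rule char_poly_similar[OF sim])
  also have "\<dots> = (\<Prod>a\<leftarrow>diag_mat B. [:- a, 1:])" by (rule char_poly_upper_triangular[OF B ut])
  finally have "poly (char_poly A) (B $$ (i, i)) = 0"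
    using i B by (auto simp: poly_prod_list prod_list_zero_iff diag_mat_def)
  hence "eigenvalue A (B $$ (i, i))" using eigenvalue_root_char_poly[OF A] by simp
  thus thesis using i that by blast
qed

section \<open>Orthonormal families\<close>

lemma orthonormal_family_inner:
  assumes "orthonormal_family n r e" "k < r" "l < r"
  shows "(\<Sum>i<n. cnj (e l $ i) * e k $ i) = (if k = l then 1 else 0)"
proof -
  have c: "e k \<in> carrier_vec n" "e l \<in> carrier_vec n" using assms by (auto simp: orthonormal_family_def)
  have "e k \<bullet>c e l = (\<Sum>i<n. e k $ i * cnj (e l $ i))"
    using carrier_vecD[OF c(1)] carrier_vecD[OF c(2)] by (simp add: scalar_prod_def atLeast0LessThan)
  thus ?thesis using assms by (simp add: orthonormal_family_def mult.commute)
qed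

lemma norm_orthonormal_combination:
  assumes "orthonormal_family n r e"
  shows "(\<Sum>i<n. (cmod (\<Sum>k<r. e k $ i * a k))\<^sup>2) = (\<Sum>k<r. (cmod (a k))\<^sup>2)"
proof -
  have "complex_of_real (\<Sum>i<n. (cmod (\<Sum>k<r. e k $ i * a k))\<^sup>2)
      = (\<Sum>m<r. \<Sum>l<r. a m * cnj (a l) * (if m = l then 1 else 0))"
    unfolding cmod_square_sum_expand
    by (intro sum.cong refl) (simp add: orthonormal_family_inner[OF assms])
  also have "\<dots> = (\<Sum>m<r. a m * cnj (a m))" by (simp add: if_distrib[of "(*) _"] cong: if_cong)
  also have "\<dots> = complex_of_real (\<Sum>m<r. (cmod (a m))\<^sup>2)"
    by (simp only: of_real_sum complex_norm_square)
  finally show ?thesis by (simp only: of_real_eq_iff)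
qed

lemma orthonormal_family_norm:
  assumes "orthonormal_family n r e" "k < r"
  shows "(\<Sum>i<n. (cmod (e k $ i))\<^sup>2) = 1"
proof -
  have "complex_of_real (\<Sum>i<n. (cmod (e k $ i))\<^sup>2) = (\<Sum>i<n. cnj (e k $ i) * e k $ i)"
    by (simp only: of_real_sum complex_norm_square mult.commute)
  also have "\<dots> = complex_of_real 1" using orthonormal_family_inner[OF assms(1) assms(2) assms(2)] by simp
  finally show ?thesis by (simp only: of_real_eq_iff)
qed

text \<open>Bessel's inequality for the standard basis vector with index \<open>i\<close>: its
  projection onto the span has \<open>i\<close>-th entry \<open>s\<close> and squared norm
  \<open>s\<close>, hence \<open>s\<^sup>2 \<le> s\<close>.\<close>

lemma orthonormal_family_bessel:
  assumes on: "orthonormal_family n r e" and i: "i < n"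
  shows "(\<Sum>k<r. (cmod (e k $ i))\<^sup>2) \<le> 1"
proof -
  define s where "s = (\<Sum>k<r. (cmod (e k $ i))\<^sup>2)"
  have s0: "0 \<le> s" unfolding s_def by (intro sum_nonneg) auto
  have "(\<Sum>k<r. e k $ i * cnj (e k $ i)) = complex_of_real s"
    unfolding s_def by (simp only: of_real_sum complex_norm_square)
  hence "s\<^sup>2 = (cmod (\<Sum>k<r. e k $ i * cnj (e k $ i)))\<^sup>2" by simp
  also have "\<dots> \<le> (\<Sum>j<n. (cmod (\<Sum>k<r. e k $ j * cnj (e k $ i)))\<^sup>2)"
    using i by (intro member_le_sum) auto
  also have "\<dots> = s" unfolding norm_orthonormal_combination[OF on] s_def by simp
  finally have "s * s \<le> s * 1" by (simp add: power2_eq_square)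
  hence "s \<le> 1" using s0 by (cases "s = 0") (auto simp: mult_le_cancel_left)
  thus ?thesis by (simp add: s_def)
qed

text \<open>Double counting: all \<open>(cmod (e k $ i))\<^sup>2\<close> together sum to
  \<open>r\<close>, and by Bessel each \<open>i\<close> contributes at most 1. This bounds the size
  of a singular system.\<close>

lemma orthonormal_family_card:
  assumes on: "orthonormal_family n r e"
  shows "r \<le> n"
proof -
  have "real r = (\<Sum>k<r. \<Sum>i<n. (cmod (e k $ i))\<^sup>2)"
    by (simp add: orthonormal_family_norm[OF on])
  also have "\<dots> = (\<Sum>i<n. \<Sum>k<r. (cmod (e k $ i))\<^sup>2)" by (rule sum.swap)
  also have "\<dots> \<le> (\<Sum>i<n. 1)" by (intro sum_mono orthonormal_family_bessel[OF on]) simp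
  finally show ?thesis by simp
qed

text \<open>A partial singular value decomposition of \<open>M\<close>, which need not exhaust it.
  The \<open>f k\<close> are conjugates of the usual right singular vectors, so that
  \<open>M\<close> expands into the products \<open>e k $ i * f k $ j\<close> of a Schmidt
  decomposition.\<close>

definition singular_system ::
  "nat \<Rightarrow> nat \<Rightarrow> (nat \<Rightarrow> nat \<Rightarrow> complex) \<Rightarrow> nat \<Rightarrow> (nat \<Rightarrow> real) \<Rightarrow>
   (nat \<Rightarrow> complex vec) \<Rightarrow> (nat \<Rightarrow> complex vec) \<Rightarrow> bool" where
  "singular_system m n M r c e f \<longleftrightarrow>
     (\<forall>k<r. 0 < c k) \<and> orthonormal_family m r e \<and> orthonormal_family n r f \<and>
     (\<forall>k<r. \<forall>j<n. (\<Sum>i<m. cnj (e k $ i) * M i j) = c k * f k $ j) \<and>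
     (\<forall>k<r. \<forall>i<m. (\<Sum>j<n. M i j * cnj (f k $ j)) = c k * e k $ i)"

lemma orthonormal_family_extend:
  assumes on: "orthonormal_family n r e" and u: "u \<in> carrier_vec n"
    and norm: "(\<Sum>i<n. cnj (u $ i) * u $ i) = 1"
    and orth: "\<And>k. k < r \<Longrightarrow> (\<Sum>i<n. cnj (e k $ i) * u $ i) = 0"
  shows "orthonormal_family n (Suc r) (e(r := u))"
proof -
  have c: "e k \<in> carrier_vec n" if "k < r" for k using on that by (simp add: orthonormal_family_def)
  have ip: "a \<bullet>c b = (\<Sum>i<n. cnj (b $ i) * a $ i)" if "a \<in> carrier_vec n" "b \<in> carrier_vec n" for a b
    using carrier_vecD[OF that(1)] carrier_vecD[OF that(2)]
    by (simp add: scalar_prod_def atLeast0LessThan mult.commute)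
  have 1: "u \<bullet>c u = 1" using norm ip[OF u u] by simp
  have 2: "u \<bullet>c e k = 0" if "k < r" for k using ip[OF u c[OF that]] orth[OF that] by simp
  have 3: "e k \<bullet>c u = 0" if "k < r" for k
  proof -
    have "e k \<bullet>c u = cnj (\<Sum>i<n. cnj (e k $ i) * u $ i)"
      unfolding ip[OF c[OF that] u] cnj_sum by (simp add: mult.commute)
    thus ?thesis using orth[OF that] by simp
  qed
  show ?thesis
    using on u 1 2 3 unfolding orthonormal_family_def by (auto simp: less_Suc_eq)
qed

text \<open>Deflation. The residual \<open>N\<close> is annihilated from both sides by the vectors
  found so far. If it has a nonzero entry, \<open>N\<close> times its adjoint has positive trace and
  hence an eigenvector \<open>u\<close> with nonzero eigenvalue; \<open>u\<close> and the normalised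
  product of its adjoint with \<open>N\<close> form the new pair.\<close>

lemma singular_system_extend:
  assumes S: "singular_system m n M r c e f"
    and ne: "i0 < m" "j0 < n" "M i0 j0 \<noteq> (\<Sum>k<r. c k * e k $ i0 * f k $ j0)"
  obtains c' e' f' where "singular_system m n M (Suc r) c' e' f'"
proof -
  define N where "N = (\<lambda>i j. M i j - (\<Sum>k<r. c k * e k $ i * f k $ j))"
  from S have c0: "\<And>k. k < r \<Longrightarrow> 0 < c k" and on: "orthonormal_family m r e" "orthonormal_family n r f"
    and left: "\<And>k j. k < r \<Longrightarrow> j < n \<Longrightarrow> (\<Sum>i<m. cnj (e k $ i) * M i j) = c k * f k $ j"
    and right: "\<And>k i. k < r \<Longrightarrow> i < m \<Longrightarrow> (\<Sum>j<n. M i j * cnj (f k $ j)) = c k * e k $ i"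
    unfolding singular_system_def by auto
  have leftN: "(\<Sum>i<m. cnj (e k $ i) * N i j) = 0" if "k < r" "j < n" for k j
  proof -
    have "(\<Sum>i<m. cnj (e k $ i) * N i j)
        = c k * f k $ j - (\<Sum>i<m. \<Sum>l<r. c l * f l $ j * (cnj (e k $ i) * e l $ i))"
      unfolding left[OF that, symmetric] N_def
      by (simp add: right_diff_distrib sum_subtractf sum_distrib_left mult_ac)
    also have "(\<Sum>i<m. \<Sum>l<r. c l * f l $ j * (cnj (e k $ i) * e l $ i))
        = (\<Sum>l<r. \<Sum>i<m. c l * f l $ j * (cnj (e k $ i) * e l $ i))" by (rule sum.swap)
    also have "\<dots> = (\<Sum>l<r. c l * f l $ j * (if l = k then 1 else 0))"
      using that by (simp only: sum_distrib_left[symmetric])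
        (simp add: orthonormal_family_inner[OF on(1)])
    also have "\<dots> = c k * f k $ j" using that by (simp add: if_distrib[of "(*) _"] cong: if_cong)
    finally show ?thesis by simp
  qed
  have rightN: "(\<Sum>j<n. N i j * cnj (f k $ j)) = 0" if "k < r" "i < m" for k i
  proof -
    have "(\<Sum>j<n. N i j * cnj (f k $ j))
        = c k * e k $ i - (\<Sum>j<n. \<Sum>l<r. c l * e l $ i * (cnj (f k $ j) * f l $ j))"
      unfolding right[OF that, symmetric] N_def
      by (simp add: right_diff_distrib sum_subtractf sum_distrib_left mult_ac)
    also have "(\<Sum>j<n. \<Sum>l<r. c l * e l $ i * (cnj (f k $ j) * f l $ j))
        = (\<Sum>l<r. \<Sum>j<n. c l * e l $ i * (cnj (f k $ j) * f l $ j))" by (rule sum.swap)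
    also have "\<dots> = (\<Sum>l<r. c l * e l $ i * (if l = k then 1 else 0))"
      using that by (simp only: sum_distrib_left[symmetric])
        (simp add: orthonormal_family_inner[OF on(2)])
    also have "\<dots> = c k * e k $ i" using that by (simp add: if_distrib[of "(*) _"] cong: if_cong)
    finally show ?thesis by simp
  qed
  define H where "H = mat m m (\<lambda>(i, l). \<Sum>j<n. N i j * cnj (N l j))"
  have H: "H \<in> carrier_mat m m" by (simp add: H_def)
  have "mat_trace H = (\<Sum>i<m. \<Sum>j<n. N i j * cnj (N i j))" by (simp add: mat_trace_def H_def)
  also have "\<dots> = complex_of_real (\<Sum>i<m. \<Sum>j<n. (cmod (N i j))\<^sup>2)"
    by (simp only: of_real_sum complex_norm_square)
  finally have trH: "mat_trace H = complex_of_real (\<Sum>i<m. \<Sum>j<n. (cmod (N i j))\<^sup>2)" .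
  have "(\<Sum>i<m. \<Sum>j<n. (cmod (N i j))\<^sup>2) > 0"
  proof -
    have "0 < (cmod (N i0 j0))\<^sup>2" using ne by (simp add: N_def)
    also have "\<dots> \<le> (\<Sum>j<n. (cmod (N i0 j))\<^sup>2)" using ne by (intro member_le_sum) auto
    also have "\<dots> \<le> (\<Sum>i<m. \<Sum>j<n. (cmod (N i j))\<^sup>2)"
      using ne by (intro member_le_sum[of _ _ "\<lambda>i. \<Sum>j<n. (cmod (N i j))\<^sup>2"] sum_nonneg) auto
    finally show ?thesis .
  qed
  hence "mat_trace H \<noteq> 0" unfolding trH of_real_eq_0_iff by (rule less_imp_neq[symmetric])
  then obtain \<mu> where \<mu>: "eigenvalue H \<mu>" "\<mu> \<noteq> 0"
    using nonzero_eigenvalue_if_trace_nonzero[OF H] by blast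
  then obtain u0 where u0: "u0 \<in> carrier_vec m" "u0 \<noteq> 0\<^sub>v m" "H *\<^sub>v u0 = \<mu> \<cdot>\<^sub>v u0"
    using H unfolding eigenvalue_def eigenvector_def by auto
  define s where "s = (\<Sum>i<m. (cmod (u0 $ i))\<^sup>2)"
  have "s > 0"
  proof -
    obtain i where i: "i < m" "u0 $ i \<noteq> 0"
    proof (rule ccontr)
      assume "\<not> thesis"
      hence "u0 = 0\<^sub>v m" using u0(1) that by (intro eq_vecI) auto
      thus False using u0(2) by simp
    qed
    have "0 < (cmod (u0 $ i))\<^sup>2" using i by simp
    also have "\<dots> \<le> s" unfolding s_def using i by (intro member_le_sum) auto
    finally show ?thesis .
  qed
  define u where "u = vec m (\<lambda>i. u0 $ i / complex_of_real (sqrt s))"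
  have u: "u \<in> carrier_vec m" by (simp add: u_def)
  have u1: "(\<Sum>i<m. (cmod (u $ i))\<^sup>2) = 1"
  proof -
    have "(\<Sum>i<m. (cmod (u $ i))\<^sup>2) = (\<Sum>i<m. (cmod (u0 $ i))\<^sup>2 / s)"
      using \<open>s > 0\<close> by (intro sum.cong refl) (simp add: u_def norm_divide power_divide)
    thus ?thesis using \<open>s > 0\<close> by (simp add: sum_divide_distrib[symmetric] s_def[symmetric])
  qed
  have u1': "(\<Sum>i<m. cnj (u $ i) * u $ i) = 1"
  proof -
    have "(\<Sum>i<m. cnj (u $ i) * u $ i) = complex_of_real (\<Sum>i<m. (cmod (u $ i))\<^sup>2)"
      by (simp only: of_real_sum complex_norm_square mult.commute)
    thus ?thesis by (simp add: u1)
  qed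
  have Hu: "(\<Sum>l<m. H $$ (i, l) * u $ l) = \<mu> * u $ i" if "i < m" for i
  proof -
    have "(\<Sum>l<m. H $$ (i, l) * u0 $ l) = (H *\<^sub>v u0) $ i"
      by (rule index_mult_mat_vec_sum[OF H u0(1) that, symmetric])
    hence "(\<Sum>l<m. H $$ (i, l) * u0 $ l) = \<mu> * u0 $ i"
      unfolding u0(3) using u0(1) that by simp
    thus ?thesis using that by (simp add: u_def sum_divide_distrib[symmetric])
  qed
  define g where "g = (\<lambda>j. \<Sum>i<m. cnj (u $ i) * N i j)"
  have Ng: "(\<Sum>j<n. N i j * cnj (g j)) = \<mu> * u $ i" if "i < m" for i
  proof -
    have "(\<Sum>j<n. N i j * cnj (g j)) = (\<Sum>j<n. \<Sum>l<m. N i j * cnj (N l j) * u $ l)"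
      unfolding g_def by (simp add: cnj_sum sum_distrib_left mult_ac)
    also have "\<dots> = (\<Sum>l<m. \<Sum>j<n. N i j * cnj (N l j) * u $ l)" by (rule sum.swap)
    also have "\<dots> = (\<Sum>l<m. H $$ (i, l) * u $ l)"
      using that by (simp add: H_def sum_distrib_right)
    finally show ?thesis using Hu[OF that] by simp
  qed
  \<comment> \<open>Pairing with \<open>g\<close> replaces \<open>N\<close> by a factor
    \<open>\<mu>\<close>. With \<open>a\<close> the conjugate of \<open>u\<close> this shows that
    \<open>\<mu>\<close> is real and nonnegative; with \<open>a\<close> the conjugate of
    \<open>e k\<close> it makes \<open>u\<close> orthogonal to the old vectors.\<close>
  have pair: "(\<Sum>j<n. (\<Sum>i<m. a i * N i j) * cnj (g j)) = (\<Sum>i<m. a i * (\<mu> * u $ i))" for a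
  proof -
    have "(\<Sum>j<n. (\<Sum>i<m. a i * N i j) * cnj (g j)) = (\<Sum>j<n. \<Sum>i<m. a i * (N i j * cnj (g j)))"
      by (simp add: sum_distrib_right mult.assoc)
    also have "\<dots> = (\<Sum>i<m. \<Sum>j<n. a i * (N i j * cnj (g j)))" by (rule sum.swap)
    also have "\<dots> = (\<Sum>i<m. a i * (\<Sum>j<n. N i j * cnj (g j)))" by (simp only: sum_distrib_left)
    finally show ?thesis by (simp add: Ng)
  qed
  define q where "q = (\<Sum>j<n. (cmod (g j))\<^sup>2)"
  have \<mu>q: "\<mu> = complex_of_real q"
  proof -
    have "complex_of_real q = (\<Sum>j<n. (\<Sum>i<m. cnj (u $ i) * N i j) * cnj (g j))"
      unfolding q_def of_real_sum complex_norm_square by (simp only: g_def)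
    also have "\<dots> = \<mu> * (\<Sum>i<m. cnj (u $ i) * u $ i)"
      unfolding pair by (simp add: sum_distrib_left mult_ac)
    finally show ?thesis by (simp add: u1')
  qed
  have "q \<ge> 0" unfolding q_def by (intro sum_nonneg) auto
  hence q0: "q > 0" using \<mu>(2) \<mu>q by (cases "q = 0") auto
  have sq: "complex_of_real (sqrt q) * complex_of_real (sqrt q) = complex_of_real q"
    using q0 by (simp add: of_real_mult[symmetric] del: of_real_mult)
  define h where "h = vec n (\<lambda>j. g j / complex_of_real (sqrt q))"
  have h: "h \<in> carrier_vec n" by (simp add: h_def)
  have h1: "(\<Sum>j<n. cnj (h $ j) * h $ j) = 1"
  proof -
    have "(\<Sum>j<n. cnj (h $ j) * h $ j) = (\<Sum>j<n. g j * cnj (g j) / complex_of_real q)"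
      using sq by (intro sum.cong refl) (simp add: h_def mult.commute)
    also have "\<dots> = complex_of_real q / complex_of_real q"
      unfolding sum_divide_distrib[symmetric] q_def of_real_sum complex_norm_square ..
    finally show ?thesis using q0 by simp
  qed
  have ue: "(\<Sum>i<m. cnj (e k $ i) * u $ i) = 0" if "k < r" for k
  proof -
    have "\<mu> * (\<Sum>i<m. cnj (e k $ i) * u $ i) = (\<Sum>i<m. cnj (e k $ i) * (\<mu> * u $ i))"
      by (simp add: sum_distrib_left mult_ac)
    also have "\<dots> = 0" unfolding pair[symmetric] using leftN[OF that] by simp
    finally show ?thesis using \<mu>(2) by simp
  qed
  have hf: "(\<Sum>j<n. cnj (f k $ j) * h $ j) = 0" if "k < r" for k
  proof -
    have "(\<Sum>j<n. cnj (f k $ j) * g j) = (\<Sum>j<n. \<Sum>i<m. cnj (u $ i) * (N i j * cnj (f k $ j)))"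
      unfolding g_def by (simp add: sum_distrib_left mult_ac)
    also have "\<dots> = (\<Sum>i<m. \<Sum>j<n. cnj (u $ i) * (N i j * cnj (f k $ j)))" by (rule sum.swap)
    also have "\<dots> = (\<Sum>i<m. cnj (u $ i) * (\<Sum>j<n. N i j * cnj (f k $ j)))" by (simp only: sum_distrib_left)
    also have "\<dots> = 0" using rightN[OF that] by simp
    finally show ?thesis by (simp add: h_def sum_divide_distrib[symmetric])
  qed
  have M: "M i j = N i j + (\<Sum>k<r. c k * e k $ i * f k $ j)" for i j by (simp add: N_def)
  have ueu: "(\<Sum>i<m. cnj (u $ i) * e k $ i) = 0" if "k < r" for k
  proof -
    have "(\<Sum>i<m. cnj (u $ i) * e k $ i) = cnj (\<Sum>i<m. cnj (e k $ i) * u $ i)"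
      by (simp add: cnj_sum mult.commute)
    thus ?thesis using ue[OF that] by simp
  qed
  have hfh: "(\<Sum>j<n. f k $ j * cnj (h $ j)) = 0" if "k < r" for k
  proof -
    have "(\<Sum>j<n. f k $ j * cnj (h $ j)) = cnj (\<Sum>j<n. cnj (f k $ j) * h $ j)"
      by (simp add: cnj_sum)
    thus ?thesis using hf[OF that] by simp
  qed
  have Lu: "(\<Sum>i<m. cnj (u $ i) * M i j) = complex_of_real (sqrt q) * h $ j" if "j < n" for j
  proof -
    have "(\<Sum>i<m. cnj (u $ i) * M i j)
        = g j + (\<Sum>i<m. \<Sum>k<r. c k * f k $ j * (cnj (u $ i) * e k $ i))"
      unfolding M g_def by (simp add: distrib_left sum.distrib sum_distrib_left mult_ac)
    also have "(\<Sum>i<m. \<Sum>k<r. c k * f k $ j * (cnj (u $ i) * e k $ i))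
        = (\<Sum>k<r. \<Sum>i<m. c k * f k $ j * (cnj (u $ i) * e k $ i))" by (rule sum.swap)
    also have "\<dots> = 0" by (simp only: sum_distrib_left[symmetric]) (simp add: ueu)
    finally show ?thesis using that q0 by (simp add: h_def)
  qed
  have Rh: "(\<Sum>j<n. M i j * cnj (h $ j)) = complex_of_real (sqrt q) * u $ i" if "i < m" for i
  proof -
    have "(\<Sum>j<n. M i j * cnj (h $ j))
        = (\<Sum>j<n. N i j * cnj (h $ j)) + (\<Sum>j<n. \<Sum>k<r. c k * e k $ i * (f k $ j * cnj (h $ j)))"
      unfolding M by (simp add: distrib_left sum.distrib sum_distrib_left mult_ac)
    also have "(\<Sum>j<n. \<Sum>k<r. c k * e k $ i * (f k $ j * cnj (h $ j)))
        = (\<Sum>k<r. \<Sum>j<n. c k * e k $ i * (f k $ j * cnj (h $ j)))" by (rule sum.swap)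
    also have "\<dots> = 0" by (simp only: sum_distrib_left[symmetric]) (simp add: hfh)
    also have "(\<Sum>j<n. N i j * cnj (h $ j)) = \<mu> * u $ i / complex_of_real (sqrt q)"
      unfolding Ng[OF that, symmetric] by (simp add: h_def sum_divide_distrib)
    also have "\<dots> = complex_of_real (sqrt q) * u $ i"
      unfolding \<mu>q sq[symmetric] using q0 by simp
    finally show ?thesis by simp
  qed
  have "singular_system m n M (Suc r) (c(r := sqrt q)) (e(r := u)) (f(r := h))"
    unfolding singular_system_def
    using orthonormal_family_extend[OF on(1) u u1' ue] orthonormal_family_extend[OF on(2) h h1 hf]
      c0 q0 left right Lu Rh
    by (auto simp: less_Suc_eq)
  thus thesis by (rule that)
qed

text \<open>The size of a singular system is bounded by \<open>m\<close>, so a largest one exists;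
  an entry of \<open>M\<close> that it misses would allow an extension.\<close>

lemma singular_system_max:
  obtains r c e f where "singular_system m n M r c e f"
    "\<And>i j. i < m \<Longrightarrow> j < n \<Longrightarrow> M i j = (\<Sum>k<r. c k * e k $ i * f k $ j)"
proof -
  define Q where "Q = (\<lambda>r. \<exists>c e f. singular_system m n M r c e f)"
  have "Q 0" by (auto simp: Q_def singular_system_def orthonormal_family_def)
  moreover have "\<forall>r. Q r \<longrightarrow> r \<le> m"
    by (auto simp: Q_def singular_system_def intro: orthonormal_family_card)
  ultimately obtain r where r: "Q r" "\<forall>r'. Q r' \<longrightarrow> r' \<le> r"
    using GreatestI_nat[of Q 0 m] Greatest_le_nat[of Q _ m] by blast
  then obtain c e f where S: "singular_system m n M r c e f" unfolding Q_def by blast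
  have "M i j = (\<Sum>k<r. c k * e k $ i * f k $ j)" if "i < m" "j < n" for i j
  proof (rule ccontr)
    assume "M i j \<noteq> (\<Sum>k<r. c k * e k $ i * f k $ j)"
    from singular_system_extend[OF S that this] have "Q (Suc r)" unfolding Q_def by blast
    thus False using r(2) by auto
  qed
  with S show thesis by (rule that)
qed

section \<open>From singular systems to Schmidt decompositions\<close>

lemma index_tensor_vec:
  assumes "u \<in> carrier_vec m" "w \<in> carrier_vec n" "i < m" "j < n"
  shows "tensor_vec u w $ (i * n + j) = u $ i * w $ j"
  using assms carrier_vecD[OF assms(1)] carrier_vecD[OF assms(2)]
  by (simp add: tensor_vec_def prod_index_less)

lemma all_less_mult_iff: "(\<forall>i < m * n. Q i) \<longleftrightarrow> (\<forall>i < m. \<forall>j < n. Q (i * n + j :: nat))"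
proof (intro iffI allI impI)
  fix i assume *: "\<forall>i<m. \<forall>j<n. Q (i * n + j)" and i: "i < m * n"
  hence "n > 0" by (cases n) auto
  hence "i mod n < n" "i div n < m" using i by (auto simp: less_mult_imp_div_less)
  with * have "Q (i div n * n + i mod n)" by blast
  thus "Q i" by simp
qed (auto simp: prod_index_less)

lemma schmidt_decomposition_index:
  assumes "schmidt_decomposition dA dB v r c e f" "i < dA" "j < dB"
  shows "v $ (i * dB + j) = (\<Sum>k<r. c k * e k $ i * f k $ j)"
proof -
  have "v $ (i * dB + j) = (\<Sum>k<r. c k * tensor_vec (e k) (f k) $ (i * dB + j))"
    using assms unfolding schmidt_decomposition_def all_less_mult_iff by blast
  also have "\<dots> = (\<Sum>k<r. c k * e k $ i * f k $ j)"
    using assms by (intro sum.cong refl)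
      (simp add: schmidt_decomposition_def orthonormal_family_def index_tensor_vec[where m = dA])
  finally show ?thesis .
qed

lemma schmidt_decomposition_exists:
  assumes v: "v \<in> carrier_vec (dA * dB)"
  obtains r c e f where "schmidt_decomposition dA dB v r c e f"
proof -
  obtain r c e f where S: "singular_system dA dB (\<lambda>i j. v $ (i * dB + j)) r c e f"
    and M: "\<And>i j. i < dA \<Longrightarrow> j < dB \<Longrightarrow> v $ (i * dB + j) = (\<Sum>k<r. c k * e k $ i * f k $ j)"
    using singular_system_max[of dA dB "\<lambda>i j. v $ (i * dB + j)"] by blast
  have "v $ (i * dB + j) = (\<Sum>k<r. c k * tensor_vec (e k) (f k) $ (i * dB + j))"
    if "i < dA" "j < dB" for i j
    unfolding M[OF that] using S that by (intro sum.cong refl)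
      (simp add: singular_system_def orthonormal_family_def index_tensor_vec[where m = dA])
  hence "schmidt_decomposition dA dB v r c e f"
    using v S unfolding schmidt_decomposition_def all_less_mult_iff singular_system_def by blast
  thus thesis by (rule that)
qed

lemma schmidt_decomposition_apply:
  assumes S: "schmidt_decomposition dA dB v r c e f" and k: "k < r"
  shows "i < dA \<Longrightarrow> (\<Sum>j<dB. v $ (i * dB + j) * cnj (f k $ j)) = c k * e k $ i"
    and "j < dB \<Longrightarrow> (\<Sum>i<dA. cnj (e k $ i) * v $ (i * dB + j)) = c k * f k $ j"
proof -
  from S have on: "orthonormal_family dA r e" "orthonormal_family dB r f"
    unfolding schmidt_decomposition_def by auto
  note idx = schmidt_decomposition_index[OF S]
  show "(\<Sum>j<dB. v $ (i * dB + j) * cnj (f k $ j)) = c k * e k $ i" if i: "i < dA"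
  proof -
    have "(\<Sum>j<dB. v $ (i * dB + j) * cnj (f k $ j))
        = (\<Sum>j<dB. \<Sum>l<r. c l * e l $ i * (cnj (f k $ j) * f l $ j))"
      using i by (intro sum.cong refl, simp add: idx, simp add: sum_distrib_left mult_ac)
    also have "\<dots> = (\<Sum>l<r. \<Sum>j<dB. c l * e l $ i * (cnj (f k $ j) * f l $ j))" by (rule sum.swap)
    also have "\<dots> = (\<Sum>l<r. c l * e l $ i * (if l = k then 1 else 0))"
      using k by (simp only: sum_distrib_left[symmetric])
        (simp add: orthonormal_family_inner[OF on(2)])
    also have "\<dots> = c k * e k $ i" using k by (simp add: if_distrib[of "(*) _"] cong: if_cong)
    finally show ?thesis .
  qed
  show "(\<Sum>i<dA. cnj (e k $ i) * v $ (i * dB + j)) = c k * f k $ j" if j: "j < dB"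
  proof -
    have "(\<Sum>i<dA. cnj (e k $ i) * v $ (i * dB + j))
        = (\<Sum>i<dA. \<Sum>l<r. c l * f l $ j * (cnj (e k $ i) * e l $ i))"
      using j by (intro sum.cong refl, simp add: idx, simp add: sum_distrib_left mult_ac)
    also have "\<dots> = (\<Sum>l<r. \<Sum>i<dA. c l * f l $ j * (cnj (e k $ i) * e l $ i))" by (rule sum.swap)
    also have "\<dots> = (\<Sum>l<r. c l * f l $ j * (if l = k then 1 else 0))"
      using k by (simp only: sum_distrib_left[symmetric])
        (simp add: orthonormal_family_inner[OF on(1)])
    also have "\<dots> = c k * f k $ j" using k by (simp add: if_distrib[of "(*) _"] cong: if_cong)
    finally show ?thesis .
  qed
qed

lemma schmidt_coefficients_sum_squares:
  assumes S: "schmidt_decomposition dA dB v r c e f"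
  shows "norm_sq v = (\<Sum>k<r. (c k)\<^sup>2)"
proof -
  from S have on: "orthonormal_family dA r e" "orthonormal_family dB r f"
    and v: "v \<in> carrier_vec (dA * dB)" unfolding schmidt_decomposition_def by auto
  have "norm_sq v = (\<Sum>j<dB. \<Sum>i<dA. (cmod (v $ (i * dB + j)))\<^sup>2)"
    unfolding norm_sq_bipartite[OF v] by (rule sum.swap)
  also have "\<dots> = (\<Sum>j<dB. \<Sum>i<dA. (cmod (\<Sum>k<r. e k $ i * (c k * f k $ j)))\<^sup>2)"
    by (intro sum.cong refl, simp add: schmidt_decomposition_index[OF S], simp add: mult_ac)
  also have "\<dots> = (\<Sum>j<dB. \<Sum>k<r. (c k)\<^sup>2 * (cmod (f k $ j))\<^sup>2)"
    unfolding norm_orthonormal_combination[OF on(1)] by (simp add: norm_mult power_mult_distrib)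
  also have "\<dots> = (\<Sum>k<r. \<Sum>j<dB. (c k)\<^sup>2 * (cmod (f k $ j))\<^sup>2)" by (rule sum.swap)
  also have "\<dots> = (\<Sum>k<r. (c k)\<^sup>2)"
    by (simp only: sum_distrib_left[symmetric]) (simp add: orthonormal_family_norm[OF on(2)])
  finally show ?thesis .
qed

text \<open>\<open>schmidt_coefficients\<close> collects from all Schmidt decompositions of
  \<open>v\<close>, possibly infinitely many. Finiteness, which gives \<open>Max\<close> its
  meaning, holds because each squared coefficient is an eigenvalue of \<open>H\<close>, the
  coefficient matrix times its adjoint, and \<open>H\<close> depends on \<open>v\<close>
  alone.\<close>

lemma finite_schmidt_coefficients:
  assumes v: "v \<in> carrier_vec (dA * dB)"
  shows "finite (schmidt_coefficients dA dB v)"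
proof -
  define H where "H = mat dA dA (\<lambda>(i, l). \<Sum>j<dB. v $ (i * dB + j) * cnj (v $ (l * dB + j)))"
  have H: "H \<in> carrier_mat dA dA" by (simp add: H_def)
  have "schmidt_coefficients dA dB v \<subseteq> (\<lambda>\<mu>. sqrt (Re \<mu>)) ` spectrum H"
  proof
    fix s assume "s \<in> schmidt_coefficients dA dB v"
    then obtain r c e f k where S: "schmidt_decomposition dA dB v r c e f" and k: "k < r" "s = c k"
      unfolding schmidt_coefficients_def by blast
    from S k have c0: "0 < c k" and on: "orthonormal_family dA r e"
      and ek: "e k \<in> carrier_vec dA" by (auto simp: schmidt_decomposition_def orthonormal_family_def)
    have "H *\<^sub>v e k = complex_of_real ((c k)\<^sup>2) \<cdot>\<^sub>v e k"
    proof (rule eq_vecI)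
      fix i assume "i < dim_vec (complex_of_real ((c k)\<^sup>2) \<cdot>\<^sub>v e k)"
      hence i: "i < dA" using ek by simp
      have "(H *\<^sub>v e k) $ i
          = (\<Sum>l<dA. \<Sum>j<dB. v $ (i * dB + j) * cnj (cnj (e k $ l) * v $ (l * dB + j)))"
        unfolding index_mult_mat_vec_sum[OF H ek i] using i
        by (simp add: H_def sum_distrib_left mult_ac)
      also have "\<dots> = (\<Sum>j<dB. \<Sum>l<dA. v $ (i * dB + j) * cnj (cnj (e k $ l) * v $ (l * dB + j)))"
        by (rule sum.swap)
      also have "\<dots> = (\<Sum>j<dB. v $ (i * dB + j) * cnj (\<Sum>l<dA. cnj (e k $ l) * v $ (l * dB + j)))"
        by (simp only: sum_distrib_left cnj_sum)
      also have "\<dots> = (\<Sum>j<dB. c k * (v $ (i * dB + j) * cnj (f k $ j)))"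
        by (simp add: schmidt_decomposition_apply(2)[OF S k(1)] mult_ac)
      also have "\<dots> = complex_of_real ((c k)\<^sup>2) * e k $ i"
        by (simp only: sum_distrib_left[symmetric] schmidt_decomposition_apply(1)[OF S k(1) i])
          (simp add: power2_eq_square)
      finally show "(H *\<^sub>v e k) $ i = (complex_of_real ((c k)\<^sup>2) \<cdot>\<^sub>v e k) $ i"
        using i ek by simp
    qed (use H ek in auto)
    moreover have "e k \<noteq> 0\<^sub>v dA"
    proof
      assume "e k = 0\<^sub>v dA"
      thus False using orthonormal_family_norm[OF on k(1)] by simp
    qed
    ultimately have "eigenvector H (e k) (complex_of_real ((c k)\<^sup>2))"
      using H ek unfolding eigenvector_def by auto
    hence "complex_of_real ((c k)\<^sup>2) \<in> spectrum H"
      unfolding spectrum_def eigenvalue_def by blast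
    moreover have "s = sqrt (Re (complex_of_real ((c k)\<^sup>2)))" using k c0 by simp
    ultimately show "s \<in> (\<lambda>\<mu>. sqrt (Re \<mu>)) ` spectrum H" by (rule rev_image_eqI)
  qed
  thus ?thesis using card_finite_spectrum(1)[OF H] by (rule finite_surj[rotated])
qed

lemma schmidt_coefficient_le_lambda_max:
  assumes S: "schmidt_decomposition dA dB v r c e f" and k: "k < r"
  shows "(c k)\<^sup>2 \<le> lambda_max dA dB v"
proof -
  have "v \<in> carrier_vec (dA * dB)" using S by (simp add: schmidt_decomposition_def)
  moreover have "c k \<in> schmidt_coefficients dA dB v"
    using S k unfolding schmidt_coefficients_def by blast
  ultimately show ?thesis
    unfolding lambda_max_def by (intro Max_ge finite_imageI finite_schmidt_coefficients) auto
qed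

lemma lambda_max_overlap:
  assumes v: "v \<in> carrier_vec (dA * dB)" and norm: "norm_sq v = 1"
  obtains x where "(\<Sum>j<dB. (cmod (x j))\<^sup>2) \<le> 1" "overlap dA dB v x = lambda_max dA dB v"
proof -
  obtain r c e f where S: "schmidt_decomposition dA dB v r c e f"
    using schmidt_decomposition_exists[OF v] .
  \<comment> \<open>Norm 1 excludes the empty decomposition, so \<open>Max\<close> is taken over a
    nonempty set and is attained.\<close>
  have "r \<noteq> 0" using norm schmidt_coefficients_sum_squares[OF S] by (cases "r = 0") auto
  hence "c 0 \<in> schmidt_coefficients dA dB v"
    using S unfolding schmidt_coefficients_def by blast
  hence "lambda_max dA dB v \<in> (\<lambda>s. s\<^sup>2) ` schmidt_coefficients dA dB v"
    unfolding lambda_max_def by (intro Max_in finite_imageI finite_schmidt_coefficients[OF v]) auto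
  then obtain r c e f k where S: "schmidt_decomposition dA dB v r c e f" and k: "k < r"
    and l: "lambda_max dA dB v = (c k)\<^sup>2"
    unfolding schmidt_coefficients_def by blast
  from S have on: "orthonormal_family dA r e" "orthonormal_family dB r f"
    unfolding schmidt_decomposition_def by auto
  show thesis
  proof (rule that[of "\<lambda>j. cnj (f k $ j)"])
    show "(\<Sum>j<dB. (cmod (cnj (f k $ j)))\<^sup>2) \<le> 1"
      using orthonormal_family_norm[OF on(2) k] by simp
    have "overlap dA dB v (\<lambda>j. cnj (f k $ j)) = (\<Sum>i<dA. (c k)\<^sup>2 * (cmod (e k $ i))\<^sup>2)"
      unfolding overlap_def
      by (intro sum.cong refl) (simp add: schmidt_decomposition_apply(1)[OF S k] norm_mult power_mult_distrib)
    also have "\<dots> = (c k)\<^sup>2"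
      by (simp only: sum_distrib_left[symmetric] orthonormal_family_norm[OF on(1) k])
    finally show "overlap dA dB v (\<lambda>j. cnj (f k $ j)) = lambda_max dA dB v" using l by simp
  qed
qed

section \<open>An optimal protocol\<close>

definition interval_overlap :: "real \<Rightarrow> real \<Rightarrow> real \<Rightarrow> real \<Rightarrow> real" where
  "interval_overlap a b c d = max 0 (min b d - max a c)"

lemma interval_overlap_commute: "interval_overlap a b c d = interval_overlap c d a b"
  unfolding interval_overlap_def by (simp add: min.commute max.commute)

lemma interval_overlap_split:
  "a \<le> b \<Longrightarrow> s \<le> t \<Longrightarrow> t \<le> u \<Longrightarrow>
    interval_overlap a b s t + interval_overlap a b t u = interval_overlap a b s u"
  unfolding interval_overlap_def by (auto simp: min_def max_def)

lemma sum_interval_overlap: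
  assumes "a \<le> b" "mono S"
  shows "(\<Sum>j<r. interval_overlap a b (S j) (S (Suc j))) = interval_overlap a b (S 0) (S r)"
proof (induction r)
  case 0
  show ?case using assms(1) by (auto simp: interval_overlap_def min_def max_def)
next
  case (Suc r)
  have "S 0 \<le> S r" "S r \<le> S (Suc r)" using assms(2) by (auto simp: mono_def)
  thus ?case using Suc interval_overlap_split[OF assms(1)] by simp
qed

text \<open>Lay intervals of lengths \<open>d i\<close> along a circle of circumference \<open>\<Sum>i<r. d i\<close> and let
  \<open>t i j\<close> measure the points of the first half circle that lie in interval \<open>i\<close> and whose
  antipode lies in interval \<open>j\<close>.\<close>

lemma fractional_matching_exists:
  fixes d :: "nat \<Rightarrow> real"
  assumes d0: "\<And>i. i < r \<Longrightarrow> 0 \<le> d i" and d_half: "\<And>i. i < r \<Longrightarrow> 2 * d i \<le> (\<Sum>l<r. d l)"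
  obtains t where "\<And>i j. 0 \<le> t i j" "\<And>i. i < r \<Longrightarrow> t i i = 0"
    "\<And>i. i < r \<Longrightarrow> (\<Sum>j<r. t i j + t j i) = d i"
proof -
  \<comment> \<open>Freezing the partial sums beyond \<open>r\<close> makes \<open>S\<close>
    monotone on all of \<open>nat\<close>, as \<open>sum_interval_overlap\<close> requires.\<close>
  define S where "S = (\<lambda>i. \<Sum>l<min i r. d l)"
  define h where "h = S r / 2"
  \<comment> \<open>\<open>A\<close> and \<open>B\<close> are the endpoints \<open>S i\<close>
    clipped to the first and to the second half circle, the latter rotated back by \<open>h\<close>.
    Intersecting an \<open>A\<close>-interval with a \<open>B\<close>-interval thus matches points
    with antipodes.\<close>
  define A where "A = (\<lambda>i. min (S i) h)"
  define B where "B = (\<lambda>i. max (S i) h - h)"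
  define t where "t = (\<lambda>i j. interval_overlap (A i) (A (Suc i)) (B j) (B (Suc j)))"
  have step: "S (Suc i) = S i + d i" if "i < r" for i
    using that by (simp add: S_def min_absorb1)
  have "S i \<le> S (Suc i)" for i
  proof (cases "i < r")
    case False
    thus ?thesis by (simp add: S_def min_absorb2)
  qed (use step d0 in auto)
  hence S: "mono S" by (simp add: mono_iff_le_Suc)
  have S0: "S 0 = 0" by (simp add: S_def)
  have h0: "0 \<le> h" using monoD[OF S, of 0 r] by (simp add: h_def S0)
  have A: "mono A" and B: "mono B" using S unfolding A_def B_def mono_def by (force simp: min_def max_def)+
  have ends: "A 0 = 0" "A r = h" "B 0 = 0" "B r = h"
    using h0 by (auto simp: A_def B_def S0 h_def)
  have range: "0 \<le> A i" "A i \<le> h" "0 \<le> B i" for i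
    using h0 monoD[OF S, of 0 i] by (auto simp: A_def B_def S0)
  have Br: "B i \<le> h" if "i \<le> r" for i using monoD[OF B that] by (simp add: ends)
  show thesis
  proof (rule that[of t])
    show "0 \<le> t i j" for i j by (simp add: t_def interval_overlap_def)
    \<comment> \<open>An interval of length at most \<open>h\<close> contains antipodal points at
      most at its two ends, a set of measure zero.\<close>
    show "t i i = 0" if i: "i < r" for i
    proof -
      have "2 * d i \<le> S r" using d_half[OF i] by (simp add: S_def)
      hence "S (Suc i) \<le> S i + h" using step[OF i] by (simp add: h_def)
      moreover have "0 \<le> S i" "S i \<le> S (Suc i)" using monoD[OF S, of 0 i] monoD[OF S, of i "Suc i"] S0 by auto
      ultimately show ?thesis
        using h0 unfolding t_def interval_overlap_def A_def B_def by (auto simp: min_def max_def)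
    qed
    show "(\<Sum>j<r. t i j + t j i) = d i" if i: "i < r" for i
    proof -
      have AB: "A i \<le> A (Suc i)" "B i \<le> B (Suc i)" using A B by (auto simp: mono_def)
      have "(\<Sum>j<r. t i j) = interval_overlap (A i) (A (Suc i)) 0 h"
        unfolding t_def sum_interval_overlap[OF AB(1) B] ends ..
      also have "\<dots> = A (Suc i) - A i"
        using AB range[of i] range[of "Suc i"] by (simp add: interval_overlap_def)
      finally have 1: "(\<Sum>j<r. t i j) = A (Suc i) - A i" .
      have "(\<Sum>j<r. t j i) = interval_overlap (B i) (B (Suc i)) 0 h"
        unfolding t_def interval_overlap_commute[of _ _ "B i"] sum_interval_overlap[OF AB(2) A] ends ..
      also have "\<dots> = B (Suc i) - B i"
        using AB range[of i] range[of "Suc i"] Br[of i] Br[of "Suc i"] i by (simp add: interval_overlap_def)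
      finally have 2: "(\<Sum>j<r. t j i) = B (Suc i) - B i" .
      \<comment> \<open>The two clipped parts of an interval recover its full length, since the
        minimum and the maximum of \<open>S k\<close> and \<open>h\<close> add up to
        \<open>S k + h\<close>.\<close>
      have "A k + B k = S k" for k by (simp add: A_def B_def min_def max_def)
      from this[of i] this[of "Suc i"] show ?thesis
        using 1 2 step[OF i] by (simp add: sum.distrib)
    qed
  qed
qed

text \<open>If \<open>p i0 > 1 / 2\<close>, not all weight can be matched. Then \<open>p i0\<close>
  is cut down to \<open>1 - p i0\<close>, the weight of all the others, so that \<open>i0\<close>
  holds exactly half of the new total \<open>2 * (1 - p i0)\<close>. The factor 2 in the total
  arises because a pair consumes \<open>t i j\<close> from each of its members.\<close>

lemma bell_weights_exist:
  fixes p :: "nat \<Rightarrow> real"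
  assumes p0: "\<And>i. i < r \<Longrightarrow> 0 \<le> p i" and p1: "(\<Sum>i<r. p i) = 1"
    and i0: "i0 < r" and max: "\<And>i. i < r \<Longrightarrow> p i \<le> p i0"
  obtains t where "\<And>i j. 0 \<le> t i j" "\<And>i. i < r \<Longrightarrow> t i i = 0"
    "\<And>i. i < r \<Longrightarrow> (\<Sum>j<r. t i j + t j i) \<le> p i"
    "(\<Sum>i<r. \<Sum>j<r. 2 * t i j) = min 1 (2 * (1 - p i0))"
proof -
  define d where "d = (if 2 * p i0 \<le> 1 then p else p(i0 := 1 - p i0))"
  have split: "(\<Sum>i<r. g i) = g i0 + (\<Sum>i\<in>{..<r} - {i0}. g i)" for g :: "nat \<Rightarrow> real"
    using i0 by (intro sum.remove) auto
  have rest: "(\<Sum>i\<in>{..<r} - {i0}. p i) = 1 - p i0" using p1 split[of p] by simp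
  have le: "p i \<le> 1 - p i0" if "i < r" "i \<noteq> i0" for i
    unfolding rest[symmetric] using that p0 by (intro member_le_sum) auto
  have p01: "p i0 \<le> 1" using rest p0 sum_nonneg[of "{..<r} - {i0}" p] by auto
  have D: "(\<Sum>i<r. d i) = min 1 (2 * (1 - p i0))"
  proof (cases "2 * p i0 \<le> 1")
    case True
    thus ?thesis using p1 by (simp add: d_def)
  next
    case False
    have "(\<Sum>i\<in>{..<r} - {i0}. d i) = (\<Sum>i\<in>{..<r} - {i0}. p i)"
      using False by (intro sum.cong) (auto simp: d_def)
    thus ?thesis using False by (simp add: split[of d] rest) (simp add: d_def)
  qed
  have dp: "0 \<le> d i" "d i \<le> p i" if "i < r" for i
    using p0[OF that] p01 by (auto simp: d_def)
  \<comment> \<open>For \<open>i \<noteq> i0\<close>, adding \<open>p i \<le> p i0\<close> and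
    \<open>p i \<le> 1 - p i0\<close> gives \<open>2 * p i \<le> 1\<close>; the second bound alone
    gives the other argument of the minimum.\<close>
  have half: "2 * d i \<le> (\<Sum>l<r. d l)" if "i < r" for i
    unfolding D using max[OF that] le[OF that] by (cases "i = i0") (auto simp: d_def)
  show thesis
  proof (rule fractional_matching_exists[OF dp(1) half])
    fix t :: "nat \<Rightarrow> nat \<Rightarrow> real"
    assume t: "\<And>i j. 0 \<le> t i j" "\<And>i. i < r \<Longrightarrow> t i i = 0"
      "\<And>i. i < r \<Longrightarrow> (\<Sum>j<r. t i j + t j i) = d i"
    have "(\<Sum>i<r. \<Sum>j<r. 2 * t i j) = (\<Sum>i<r. \<Sum>j<r. t i j) + (\<Sum>i<r. \<Sum>j<r. t i j)"
      by (simp add: sum_distrib_left[symmetric])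
    also have "\<dots> = (\<Sum>i<r. \<Sum>j<r. t i j) + (\<Sum>i<r. \<Sum>j<r. t j i)"
      by (subst (2) sum.swap) simp
    also have "\<dots> = (\<Sum>i<r. \<Sum>j<r. t i j + t j i)" by (simp only: sum.distrib)
    also have "\<dots> = (\<Sum>i<r. d i)" by (intro sum.cong refl) (simp only: t(3) lessThan_iff)
    finally have total: "(\<Sum>i<r. \<Sum>j<r. 2 * t i j) = min 1 (2 * (1 - p i0))" unfolding D .
    have bound: "(\<Sum>j<r. t i j + t j i) \<le> p i" if "i < r" for i
      unfolding t(3)[OF that] by (rule dp(2)[OF that])
    show thesis by (rule that[OF t(1,2) bound total])
  qed
qed

section \<open>Projectors that complete an instrument\<close>

definition family_projector :: "nat \<Rightarrow> (nat \<Rightarrow> complex vec) \<Rightarrow> nat \<Rightarrow> nat \<Rightarrow> complex" where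
  "family_projector r e i l = (\<Sum>k<r. e k $ i * cnj (e k $ l))"

lemma family_projector_apply:
  assumes on: "orthonormal_family n r e" and k: "k < r"
  shows "(\<Sum>l<n. family_projector r e i l * e k $ l) = e k $ i"
proof -
  have "(\<Sum>l<n. family_projector r e i l * e k $ l)
      = (\<Sum>l<n. \<Sum>q<r. e q $ i * (cnj (e q $ l) * e k $ l))"
    unfolding family_projector_def by (simp add: sum_distrib_right mult.assoc)
  also have "\<dots> = (\<Sum>q<r. \<Sum>l<n. e q $ i * (cnj (e q $ l) * e k $ l))" by (rule sum.swap)
  also have "\<dots> = (\<Sum>q<r. e q $ i * (if k = q then 1 else 0))"
    using k by (simp only: sum_distrib_left[symmetric]) (simp add: orthonormal_family_inner[OF on])
  also have "\<dots> = e k $ i" using k by (simp add: if_distrib[of "(*) _"] cong: if_cong)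
  finally show ?thesis .
qed

lemma cnj_family_projector: "cnj (family_projector r e i l) = family_projector r e l i"
  unfolding family_projector_def by (simp add: cnj_sum mult.commute)

text \<open>\<open>R\<close> is the complementary orthogonal projector, hence Hermitian and
  idempotent. Its rows, taken as separate Kraus operators, contribute exactly what the projector
  onto the span lacks to the identity.\<close>

lemma complement_gram:
  assumes on: "orthonormal_family n r e" and lm: "l < n" "m < n"
  defines "R \<equiv> \<lambda>i l. (if i = l then 1 else 0) - family_projector r e i l"
  shows "(\<Sum>i<n. cnj (R i l) * R i m) = R l m"
proof -
  have idem: "(\<Sum>i<n. family_projector r e l i * family_projector r e i m) = family_projector r e l m"
  proof -
    have "(\<Sum>i<n. family_projector r e l i * family_projector r e i m)
        = (\<Sum>i<n. \<Sum>k<r. family_projector r e l i * e k $ i * cnj (e k $ m))"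
      unfolding family_projector_def[of r e _ m] by (simp add: sum_distrib_left mult.assoc)
    also have "\<dots> = (\<Sum>k<r. \<Sum>i<n. family_projector r e l i * e k $ i * cnj (e k $ m))" by (rule sum.swap)
    also have "\<dots> = (\<Sum>k<r. e k $ l * cnj (e k $ m))"
      by (simp only: sum_distrib_right[symmetric]) (simp add: family_projector_apply[OF on])
    finally show ?thesis by (simp add: family_projector_def)
  qed
  have "cnj (R i l) * R i m = (if i = l then R i m else 0)
      - (if i = m then family_projector r e l i else 0)
      + family_projector r e l i * family_projector r e i m" for i
    unfolding R_def by (auto simp: cnj_family_projector algebra_simps)
  hence "(\<Sum>i<n. cnj (R i l) * R i m) = R l m - family_projector r e l m + family_projector r e l m"
    using lm by (simp add: sum.distrib sum_subtractf idem)
  thus ?thesis by simp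
qed

lemma sum_list_upt: "(\<Sum>i\<leftarrow>[0..<n]. g i) = (\<Sum>i<n. g i)" for g :: "nat \<Rightarrow> 'a::comm_monoid_add"
  by (simp add: interv_sum_list_conv_sum_set_nat atLeast0LessThan)

lemma final_bell_probability_scaled:
  assumes s: "\<sigma> \<in> carrier_mat 4 4" and t: "0 \<le> t"
    and e: "\<And>i j. i < 4 \<Longrightarrow> j < 4 \<Longrightarrow>
      \<sigma> $$ (i, j) = (if i \<in> {0, 3} \<and> j \<in> {0, 3} then complex_of_real t else 0)"
  shows "final_bell_probability [(2, 2, \<sigma>)] = 2 * t"
proof -
  have four: "(\<Sum>i<4. g i) = g 0 + g 1 + g 2 + g 3" for g :: "nat \<Rightarrow> complex"
    by (simp add: eval_nat_numeral)
  have tr: "mat_trace \<sigma> = complex_of_real (2 * t)"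
    using carrier_matD[OF s] by (simp add: mat_trace_def four e)
  show ?thesis
  proof (cases "t = 0")
    case True
    thus ?thesis by (simp add: final_bell_probability_def tr)
  next
    case False
    have h: "complex_of_real (1 / sqrt 2) * complex_of_real (1 / sqrt 2) = 1 / 2"
      by (simp only: of_real_mult[symmetric]) simp
    have "reduced_AB 1 1 ((1 / mat_trace \<sigma>) \<cdot>\<^sub>m \<sigma>) = projector bell_state"
    proof (rule eq_matI)
      have dim: "dim_vec bell_state = 4" by (simp add: bell_state_def)
      thus "dim_row (reduced_AB 1 1 ((1 / mat_trace \<sigma>) \<cdot>\<^sub>m \<sigma>)) = dim_row (projector bell_state)"
        "dim_col (reduced_AB 1 1 ((1 / mat_trace \<sigma>) \<cdot>\<^sub>m \<sigma>)) = dim_col (projector bell_state)"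
        by (simp_all add: reduced_AB_def projector_def)
      fix i j assume "i < dim_row (projector bell_state)" "j < dim_col (projector bell_state)"
      hence ij: "i < 4" "j < 4" using dim by (simp_all add: projector_def)
      have pos: "(q div 2) * 2 + q mod 2 = q" for q :: nat by simp
      have "reduced_AB 1 1 ((1 / mat_trace \<sigma>) \<cdot>\<^sub>m \<sigma>) $$ (i, j) = (1 / mat_trace \<sigma>) * \<sigma> $$ (i, j)"
        using ij s by (simp add: reduced_AB_def Let_def pos)
      also have "\<dots> = (if i \<in> {0, 3} \<and> j \<in> {0, 3} then 1 / 2 else 0)"
        using False by (simp add: e[OF ij] tr)
      also have "\<dots> = projector bell_state $$ (i, j)"
      proof -
        have "i \<in> {0, 1, 2, 3}" "j \<in> {0, 1, 2, 3}" using ij by auto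
        thus ?thesis
          unfolding projector_def bell_state_def using h
          by (auto simp: vec_of_list_index numeral_2_eq_2 numeral_3_eq_3)
      qed
      finally show "reduced_AB 1 1 ((1 / mat_trace \<sigma>) \<cdot>\<^sub>m \<sigma>) $$ (i, j) = projector bell_state $$ (i, j)" .
    qed
    hence "bell_outcome (2, 2, \<sigma>)" using False by (auto simp: tr intro!: exI[of _ 1])
    thus ?thesis by (simp add: final_bell_probability_def tr del: bell_outcome.simps)
  qed
qed

section \<open>Bob's operation\<close>

definition pair_family :: "complex vec \<Rightarrow> complex vec \<Rightarrow> nat \<Rightarrow> complex vec" where
  "pair_family u w = (\<lambda>q. if q = 0 then u else w)"

lemma orthonormal_pair_family:
  assumes "orthonormal_family n r f" "i < r" "j < r" "i \<noteq> j"
  shows "orthonormal_family n 2 (pair_family (f i) (f j))"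
  using assms by (auto simp: orthonormal_family_def pair_family_def less_2_cases_iff)

definition bob_filter :: "nat \<Rightarrow> (nat \<Rightarrow> complex vec) \<Rightarrow> complex mat" where
  "bob_filter n g = mat 2 n (\<lambda>(q, l). cnj (g q $ l))"

text \<open>Row \<open>i\<close> of the complementary projector, stored as row 0 of a matrix with
  two rows: the output is a qubit, like that of \<open>bob_filter\<close>, so both can belong to one
  branch.\<close>

definition bob_rest :: "nat \<Rightarrow> (nat \<Rightarrow> complex vec) \<Rightarrow> nat \<Rightarrow> complex mat" where
  "bob_rest n g i = mat 2 n (\<lambda>(q, l). if q = 0 then (if i = l then 1 else 0) - family_projector 2 g i l else 0)"

text \<open>The operators \<open>bob_rest\<close> only complete the instrument: they annihilate the span of
  \<open>g 0\<close> and \<open>g 1\<close>, which supports Bob's state.\<close>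

definition bob_protocol :: "nat \<Rightarrow> (nat \<Rightarrow> complex vec) \<Rightarrow> locc" where
  "bob_protocol n g = Bob [(2, bob_filter n g # map (bob_rest n g) [0..<n], Finish)]"

lemma sum_two: "(\<Sum>q<2. g q) = g 0 + g 1" for g :: "nat \<Rightarrow> 'a::comm_monoid_add"
  by (simp add: numeral_2_eq_2)

lemma bob_protocol_valid:
  assumes on: "orthonormal_family n 2 g"
  shows "locc_protocol dA n (bob_protocol n g)"
proof -
  have "instrument n [(2, bob_filter n g # map (bob_rest n g) [0..<n])]"
  proof (rule instrumentI)
    fix l m assume lm: "l < n" "m < n"
    let ?R = "\<lambda>i l. (if i = l then 1 else 0) - family_projector 2 g i l"
    have "(\<Sum>i<dim_row (bob_filter n g). cnj (bob_filter n g $$ (i, l)) * bob_filter n g $$ (i, m))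
        = family_projector 2 g l m"
      using lm by (simp add: bob_filter_def family_projector_def)
    moreover have "(\<Sum>q<dim_row (bob_rest n g i). cnj (bob_rest n g i $$ (q, l)) * bob_rest n g i $$ (q, m))
        = cnj (?R i l) * ?R i m" for i
      using lm by (simp add: bob_rest_def sum_two)
    hence "(\<Sum>K\<leftarrow>map (bob_rest n g) [0..<n]. \<Sum>q<dim_row K. cnj (K $$ (q, l)) * K $$ (q, m))
        = (\<Sum>i<n. cnj (?R i l) * ?R i m)"
      by (simp only: map_map o_def sum_list_upt)
    moreover have "\<dots> = ?R l m" by (rule complement_gram[OF on lm])
    ultimately show "(\<Sum>K\<leftarrow>concat (map snd [(2::nat, bob_filter n g # map (bob_rest n g) [0..<n])]).
        \<Sum>i<dim_row K. cnj (K $$ (i, l)) * K $$ (i, m)) = (if l = m then 1 else 0)"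
      by simp
  qed (auto simp: bob_filter_def bob_rest_def)
  thus ?thesis by (simp add: bob_protocol_def)
qed

text \<open>Up to the factor \<open>sqrt t\<close>, the vector \<open>w\<close> is |0>
  \<open>g 0\<close> plus |1> \<open>g 1\<close>. The filter maps \<open>g q\<close> to |q> and
  produces |00> + |11>, of squared norm 2; the remaining operators give 0, so the branch ends in a
  pure state.\<close>

lemma bob_protocol_probability:
  assumes on: "orthonormal_family n 2 g" and w: "w \<in> carrier_vec (2 * n)" and t: "0 \<le> t"
    and e: "\<And>q l. q < 2 \<Longrightarrow> l < n \<Longrightarrow> w $ (q * n + l) = complex_of_real (sqrt t) * g q $ l"
  shows "final_bell_probability (outcomes 2 n (ensemble (2 * n) [w]) (bob_protocol n g)) = 2 * t"
proof -
  let ?T = "\<lambda>K. tensor_mat (1\<^sub>m 2) K"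
  let ?Ks = "bob_filter n g # map (bob_rest n g) [0..<n]"
  have V: "bob_filter n g \<in> carrier_mat 2 n" and R: "bob_rest n g i \<in> carrier_mat 2 n" for i
    by (simp_all add: bob_filter_def bob_rest_def)
  have Ks: "\<forall>K\<in>set (map ?T ?Ks). K \<in> carrier_mat (2 * 2) (2 * n)"
    using tensor_mat_carrier[OF one_carrier_mat V, of 2] tensor_mat_carrier[OF one_carrier_mat R, of 2]
    by auto
  let ?vs = "concat (map (\<lambda>K. map (\<lambda>w. K *\<^sub>v w) [w]) (map ?T ?Ks))"
  have vs_eq: "?vs = (?T (bob_filter n g) *\<^sub>v w) # map (\<lambda>i. ?T (bob_rest n g i) *\<^sub>v w) [0..<n]"
    by (simp add: o_def)
  have vs: "\<forall>v\<in>set ?vs. v \<in> carrier_vec (2 * 2)"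
    using Ks w by (auto intro!: mult_mat_vec_carrier[where n = "2 * n"])
  have op: "operation (2 * 2) (map ?T ?Ks) (ensemble (2 * n) [w]) = ensemble (2 * 2) ?vs"
    by (rule operation_ensemble[OF Ks]) (use w in auto)
  have Vw: "(?T (bob_filter n g) *\<^sub>v w) $ (q * 2 + s) = complex_of_real (sqrt t) * (if q = s then 1 else 0)"
    if "q < 2" "s < 2" for q s
  proof -
    have "(?T (bob_filter n g) *\<^sub>v w) $ (q * 2 + s)
        = complex_of_real (sqrt t) * (\<Sum>l<n. cnj (g s $ l) * g q $ l)"
      unfolding index_tensor_right[OF V w that] using that
      by (simp add: e bob_filter_def, simp add: sum_distrib_left mult_ac)
    thus ?thesis using that by (simp add: orthonormal_family_inner[OF on])
  qed
  have Rw: "(?T (bob_rest n g i) *\<^sub>v w) $ (q * 2 + s) = 0" if "q < 2" "s < 2" "i < n" for q s i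
  proof (cases "s = 0")
    case True
    have "(?T (bob_rest n g i) *\<^sub>v w) $ (q * 2 + s)
        = (\<Sum>l<n. complex_of_real (sqrt t) *
            ((if i = l then g q $ l else 0) - family_projector 2 g i l * g q $ l))"
      unfolding index_tensor_right[OF R w that(1,2)] using that True
      by (intro sum.cong refl, simp add: e bob_rest_def, simp add: algebra_simps)
    also have "\<dots> = 0"
      using that by (simp only: sum_distrib_left[symmetric] sum_subtractf family_projector_apply[OF on that(1)])
        simp
    finally show ?thesis .
  next
    case False
    thus ?thesis unfolding index_tensor_right[OF R w that(1,2)] using that by (simp add: bob_rest_def)
  qed
  have "final_bell_probability [(2, 2, ensemble (2 * 2) ?vs)] = 2 * t"
  proof (rule final_bell_probability_scaled)
    show "ensemble (2 * 2) ?vs \<in> carrier_mat 4 4" using ensemble_carrier[OF vs] by simp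
    fix i j :: nat assume ij: "i < 4" "j < 4"
    have split: "k = (k div 2) * 2 + k mod 2" "k div 2 < 2" "k mod 2 < 2" if "k < 4" for k :: nat
      using that by auto
    have Vk: "(?T (bob_filter n g) *\<^sub>v w) $ k = complex_of_real (sqrt t) * (if k div 2 = k mod 2 then 1 else 0)"
      if "k < 4" for k
      by (subst split(1)[OF that], subst Vw[OF split(2,3)[OF that]]) (rule refl)
    have Rk: "(?T (bob_rest n g l) *\<^sub>v w) $ k = 0" if "k < 4" "l < n" for k l
      by (subst split(1)[OF that(1)], subst Rw[OF split(2,3)[OF that(1)] that(2)]) (rule refl)
    have "(\<Sum>l\<leftarrow>[0..<n]. (?T (bob_rest n g l) *\<^sub>v w) $ i * cnj ((?T (bob_rest n g l) *\<^sub>v w) $ j)) = 0"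
      unfolding sum_list_upt using Rk[OF ij(1)] by (intro sum.neutral) simp
    hence "ensemble (2 * 2) ?vs $$ (i, j)
        = (?T (bob_filter n g) *\<^sub>v w) $ i * cnj ((?T (bob_filter n g) *\<^sub>v w) $ j)"
      using index_ensemble[OF vs, of i j] ij unfolding vs_eq by (simp add: o_def)
    also have "\<dots> = (if i div 2 = i mod 2 \<and> j div 2 = j mod 2 then complex_of_real (sqrt t * sqrt t) else 0)"
      unfolding Vk[OF ij(1)] Vk[OF ij(2)] by (simp del: real_sqrt_mult_self)
    also have "\<dots> = (if i \<in> {0, 3} \<and> j \<in> {0, 3} then complex_of_real t else 0)"
    proof -
      have "k div 2 = k mod 2 \<longleftrightarrow> k \<in> {0, 3}" if "k < 4" for k :: nat
      proof -
        have "k \<in> {0, 1, 2, 3}" using that by auto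
        thus ?thesis by auto
      qed
      thus ?thesis using ij t by simp
    qed
    finally show "ensemble (2 * 2) ?vs $$ (i, j)
      = (if i \<in> {0, 3} \<and> j \<in> {0, 3} then complex_of_real t else 0)" .
  qed (rule t)
  moreover have "outcomes 2 n (ensemble (2 * n) [w]) (bob_protocol n g) = [(2, 2, ensemble (2 * 2) ?vs)]"
    unfolding bob_protocol_def using op by simp
  ultimately show ?thesis by simp
qed

text \<open>Dividing by \<open>c i\<close> and \<open>c j\<close> equalises the amplitudes of the
  two Schmidt vectors and leaves \<open>sqrt (t i j)\<close> times the sum of |0> \<open>f i\<close>
  and |1> \<open>f j\<close>. In the completeness relation this costs weight
  \<open>t i j / (c i)\<^sup>2\<close> on \<open>e i\<close> and
  \<open>t i j / (c j)\<^sup>2\<close> on \<open>e j\<close>, the source of the constraint on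
  \<open>t\<close>.\<close>

definition alice_filter ::
  "nat \<Rightarrow> (nat \<Rightarrow> real) \<Rightarrow> (nat \<Rightarrow> complex vec) \<Rightarrow> (nat \<Rightarrow> nat \<Rightarrow> real) \<Rightarrow> nat \<Rightarrow> nat \<Rightarrow> complex mat" where
  "alice_filter n c e t i j = mat 2 n (\<lambda>(q, l).
     complex_of_real (sqrt (t i j)) * (if q = 0 then cnj (e i $ l) / c i else cnj (e j $ l) / c j))"

text \<open>The first operators top up the weight on each \<open>e i\<close>, with
  \<open>s i\<close> the amount that the filters leave over; the others cover the complement of the
  span of the \<open>e i\<close>.\<close>

definition alice_failures ::
  "nat \<Rightarrow> nat \<Rightarrow> (nat \<Rightarrow> real) \<Rightarrow> (nat \<Rightarrow> complex vec) \<Rightarrow> complex mat list" where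
  "alice_failures n r s e =
     map (\<lambda>i. mat 1 n (\<lambda>(_, l). complex_of_real (sqrt (s i)) * cnj (e i $ l))) [0..<r] @
     map (\<lambda>i. mat 1 n (\<lambda>(_, l). (if i = l then 1 else 0) - family_projector r e i l)) [0..<n]"

text \<open>The pairs are ordered because \<open>t\<close> need not be symmetric. The diagonal is
  left out since \<open>f i\<close> taken twice is not an orthonormal pair and Bob's instrument
  would be invalid; as \<open>t i i = 0\<close>, no probability is lost.\<close>

definition index_pairs :: "nat \<Rightarrow> (nat \<times> nat) list" where
  "index_pairs r = concat (map (\<lambda>i. map (Pair i) (filter (\<lambda>j. i \<noteq> j) [0..<r])) [0..<r])"

lemma set_index_pairs: "set (index_pairs r) = {(i, j). i < r \<and> j < r \<and> i \<noteq> j}"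
  by (auto simp: index_pairs_def)

lemma sum_index_pairs:
  fixes g :: "nat \<Rightarrow> nat \<Rightarrow> 'a::comm_monoid_add"
  assumes "\<And>i. i < r \<Longrightarrow> g i i = 0"
  shows "(\<Sum>(i, j)\<leftarrow>index_pairs r. g i j) = (\<Sum>i<r. \<Sum>j<r. g i j)"
proof -
  have "(\<Sum>(i, j)\<leftarrow>index_pairs r. g i j) = (\<Sum>i<r. \<Sum>j<r. if i \<noteq> j then g i j else 0)"
    unfolding index_pairs_def sum_list_concat_map
    by (simp add: o_def sum_list_map_filter' sum_list_upt)
  also have "\<dots> = (\<Sum>i<r. \<Sum>j<r. g i j)"
    using assms by (intro sum.cong refl) auto
  finally show ?thesis .
qed

text \<open>The failure branch leaves Alice with a one-dimensional laboratory, hence never counts as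
  a Bell pair.\<close>

definition bell_protocol :: "nat \<Rightarrow> nat \<Rightarrow> nat \<Rightarrow> (nat \<Rightarrow> real) \<Rightarrow> (nat \<Rightarrow> complex vec) \<Rightarrow>
   (nat \<Rightarrow> complex vec) \<Rightarrow> (nat \<Rightarrow> nat \<Rightarrow> real) \<Rightarrow> locc" where
  "bell_protocol dA dB r c e f t = Alice
     (map (\<lambda>(i, j). (2, [alice_filter dA c e t i j], bob_protocol dB (pair_family (f i) (f j)))) (index_pairs r) @
      [(1, alice_failures dA r (\<lambda>i. 1 - (\<Sum>j<r. t i j + t j i) / (c i)\<^sup>2) e, Finish)])"

lemma alice_instrument:
  assumes on: "orthonormal_family n r e" and c: "\<And>i. i < r \<Longrightarrow> 0 < c i"
    and t: "\<And>i j. 0 \<le> t i j" "\<And>i. i < r \<Longrightarrow> t i i = 0"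
      "\<And>i. i < r \<Longrightarrow> (\<Sum>j<r. t i j + t j i) \<le> (c i)\<^sup>2"
  shows "instrument n (map (\<lambda>(i, j). (2, [alice_filter n c e t i j])) (index_pairs r) @
    [(1, alice_failures n r (\<lambda>i. 1 - (\<Sum>j<r. t i j + t j i) / (c i)\<^sup>2) e)])"
    (is "instrument n (?succ @ [(1, ?fail)])")
proof (rule instrumentI)
  fix l m assume lm: "l < n" "m < n"
  define d where "d = (\<lambda>i. \<Sum>j<r. t i j + t j i)"
  define E where "E = (\<lambda>i. e i $ l * cnj (e i $ m))"
  let ?gram = "\<lambda>K. \<Sum>i<dim_row K. cnj (K $$ (i, l)) * K $$ (i, m)"
  have dle: "d i / (c i)\<^sup>2 \<le> 1" if "i < r" for i
    using t(3)[OF that] c[OF that] by (simp add: d_def)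
  have succ: "?gram (alice_filter n c e t i j)
      = complex_of_real (t i j / (c i)\<^sup>2) * E i + complex_of_real (t i j / (c j)\<^sup>2) * E j" for i j
  proof -
    have sq: "complex_of_real (sqrt (t i j)) * complex_of_real (sqrt (t i j)) = complex_of_real (t i j)"
      using t(1)[of i j] by (simp add: of_real_mult[symmetric] del: of_real_mult)
    have "?gram (alice_filter n c e t i j)
        = (complex_of_real (sqrt (t i j)) * complex_of_real (sqrt (t i j))) * (E i / (c i)\<^sup>2)
        + (complex_of_real (sqrt (t i j)) * complex_of_real (sqrt (t i j))) * (E j / (c j)\<^sup>2)"
      using lm by (simp add: alice_filter_def sum_two E_def power2_eq_square mult_ac)
    thus ?thesis unfolding sq by simp
  qed
  have "(\<Sum>K\<leftarrow>concat (map snd ?succ). ?gram K) = (\<Sum>(i, j)\<leftarrow>index_pairs r. ?gram (alice_filter n c e t i j))"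
    unfolding sum_list_concat_map map_map o_def
    by (intro arg_cong[where f = sum_list] map_cong refl) auto
  also have "\<dots> = (\<Sum>(i, j)\<leftarrow>index_pairs r.
      complex_of_real (t i j / (c i)\<^sup>2) * E i + complex_of_real (t i j / (c j)\<^sup>2) * E j)"
    by (simp only: succ)
  also have "\<dots> = (\<Sum>i<r. \<Sum>j<r.
      complex_of_real (t i j / (c i)\<^sup>2) * E i + complex_of_real (t i j / (c j)\<^sup>2) * E j)"
    by (rule sum_index_pairs) (simp add: t(2))
  also have "\<dots> = (\<Sum>i<r. \<Sum>j<r. complex_of_real (t i j / (c i)\<^sup>2) * E i)
      + (\<Sum>i<r. \<Sum>j<r. complex_of_real (t i j / (c j)\<^sup>2) * E j)"
    by (simp only: sum.distrib)
  \<comment> \<open>\<open>e i\<close> receives weight from the pairs in which it comes first and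
    from those in which it comes second; after this swap both collect into
    \<open>d i\<close>.\<close>
  also have "(\<Sum>i<r. \<Sum>j<r. complex_of_real (t i j / (c j)\<^sup>2) * E j)
      = (\<Sum>i<r. \<Sum>j<r. complex_of_real (t j i / (c i)\<^sup>2) * E i)"
    by (rule sum.swap)
  also have "(\<Sum>i<r. \<Sum>j<r. complex_of_real (t i j / (c i)\<^sup>2) * E i) + \<dots>
      = (\<Sum>i<r. complex_of_real (d i / (c i)\<^sup>2) * E i)"
    unfolding sum.distrib[symmetric] d_def sum_divide_distrib of_real_sum sum_distrib_right
    by (intro sum.cong refl) (simp add: add_divide_distrib distrib_right)
  finally have S: "(\<Sum>K\<leftarrow>concat (map snd ?succ). ?gram K) = (\<Sum>i<r. complex_of_real (d i / (c i)\<^sup>2) * E i)" .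
  let ?R = "\<lambda>i l. (if i = l then 1 else 0) - family_projector r e i l"
  have fail_eq: "?fail = alice_failures n r (\<lambda>i. 1 - d i / (c i)\<^sup>2) e" unfolding d_def ..
  have "(\<Sum>K\<leftarrow>?fail. ?gram K) = (\<Sum>i<r. (complex_of_real (sqrt (1 - d i / (c i)\<^sup>2)) *
        complex_of_real (sqrt (1 - d i / (c i)\<^sup>2))) * E i) + (\<Sum>i<n. cnj (?R i l) * ?R i m)"
    unfolding fail_eq using lm
    by (simp add: alice_failures_def o_def sum_list_upt E_def mult_ac del: of_real_mult)
  also have "(\<Sum>i<n. cnj (?R i l) * ?R i m) = ?R l m" by (rule complement_gram[OF on lm])
  also have "(\<Sum>i<r. (complex_of_real (sqrt (1 - d i / (c i)\<^sup>2)) *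
        complex_of_real (sqrt (1 - d i / (c i)\<^sup>2))) * E i) = (\<Sum>i<r. complex_of_real (1 - d i / (c i)\<^sup>2) * E i)"
    using dle by (intro sum.cong refl) (simp add: of_real_mult[symmetric] del: of_real_mult)
  finally have F: "(\<Sum>K\<leftarrow>?fail. ?gram K) = (\<Sum>i<r. complex_of_real (1 - d i / (c i)\<^sup>2) * E i) + ?R l m" .
  have "(\<Sum>i<r. complex_of_real (d i / (c i)\<^sup>2) * E i) + (\<Sum>i<r. complex_of_real (1 - d i / (c i)\<^sup>2) * E i)
      = (\<Sum>i<r. E i)"
    unfolding sum.distrib[symmetric] by (intro sum.cong refl) (simp add: algebra_simps)
  hence total: "(\<Sum>i<r. complex_of_real (d i / (c i)\<^sup>2) * E i)
      + (\<Sum>i<r. complex_of_real (1 - d i / (c i)\<^sup>2) * E i) = family_projector r e l m"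
    by (simp only: family_projector_def E_def)
  have "(\<Sum>K\<leftarrow>concat (map snd (?succ @ [(1, ?fail)])). ?gram K)
      = (\<Sum>K\<leftarrow>concat (map snd ?succ). ?gram K) + (\<Sum>K\<leftarrow>?fail. ?gram K)"
    by (simp only: map_append concat_append sum_list_append list.map concat.simps snd_conv append_Nil2)
  also have "\<dots> = family_projector r e l m + ?R l m"
    unfolding S F add.assoc[symmetric] total ..
  finally show "(\<Sum>K\<leftarrow>concat (map snd (?succ @ [(1, ?fail)])). ?gram K) = (if l = m then 1 else 0)"
    by simp
qed (auto simp: alice_filter_def alice_failures_def)

lemma bell_protocol_valid:
  assumes S: "schmidt_decomposition dA dB v r c e f"
    and t: "\<And>i j. 0 \<le> t i j" "\<And>i. i < r \<Longrightarrow> t i i = 0"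
      "\<And>i. i < r \<Longrightarrow> (\<Sum>j<r. t i j + t j i) \<le> (c i)\<^sup>2"
  shows "locc_protocol dA dB (bell_protocol dA dB r c e f t)"
proof -
  from S have on: "orthonormal_family dA r e" "orthonormal_family dB r f" and c: "\<And>i. i < r \<Longrightarrow> 0 < c i"
    unfolding schmidt_decomposition_def by auto
  have "locc_protocol 2 dB (bob_protocol dB (pair_family (f i) (f j)))"
    if "(i, j) \<in> set (index_pairs r)" for i j
    using that by (intro bob_protocol_valid orthonormal_pair_family[OF on(2)]) (auto simp: set_index_pairs)
  thus ?thesis
    using alice_instrument[OF on(1) c t] unfolding bell_protocol_def
    by (auto simp: o_def case_prod_unfold)
qed

lemma bell_protocol_probability:
  assumes S: "schmidt_decomposition dA dB v r c e f"
    and t: "\<And>i j. 0 \<le> t i j" "\<And>i. i < r \<Longrightarrow> t i i = 0"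
  shows "bell_probability dA dB v (bell_protocol dA dB r c e f t) = (\<Sum>i<r. \<Sum>j<r. 2 * t i j)"
proof -
  from S have on: "orthonormal_family dB r f" and c: "\<And>i. i < r \<Longrightarrow> 0 < c i"
    and v: "v \<in> carrier_vec (dA * dB)"
    unfolding schmidt_decomposition_def by auto
  let ?T = "\<lambda>K. tensor_mat K (1\<^sub>m dB)"
  let ?out = "\<lambda>(d, Ks, P). outcomes d dB (operation (d * dB) (map ?T Ks) (projector v)) P"
  let ?fail = "(1, alice_failures dA r (\<lambda>i. 1 - (\<Sum>j<r. t i j + t j i) / (c i)\<^sup>2) e, Finish)"
  let ?succ = "\<lambda>(i, j). (2::nat, [alice_filter dA c e t i j], bob_protocol dB (pair_family (f i) (f j)))"
  have succ: "final_bell_probability (?out (?succ (i, j))) = 2 * t i j"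
    if ij: "(i, j) \<in> set (index_pairs r)" for i j
  proof -
    let ?K = "alice_filter dA c e t i j" and ?g = "pair_family (f i) (f j)"
    have K: "?K \<in> carrier_mat 2 dA" by (simp add: alice_filter_def)
    have ij': "i < r" "j < r" "i \<noteq> j" using ij by (auto simp: set_index_pairs)
    have w: "?T ?K *\<^sub>v v \<in> carrier_vec (2 * dB)"
      using K v by (intro mult_mat_vec_carrier[where n = "dA * dB"] tensor_mat_carrier) auto
    have "operation (2 * dB) (map ?T [?K]) (ensemble (dA * dB) [v])
        = ensemble (2 * dB) (concat (map (\<lambda>K. map (\<lambda>w. K *\<^sub>v w) [v]) (map ?T [?K])))"
      by (rule operation_ensemble) (use K v in auto)
    hence op: "operation (2 * dB) (map ?T [?K]) (projector v) = ensemble (2 * dB) [?T ?K *\<^sub>v v]"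
      by (simp add: ensemble_singleton[OF v])
    have "final_bell_probability (outcomes 2 dB (ensemble (2 * dB) [?T ?K *\<^sub>v v]) (bob_protocol dB ?g)) = 2 * t i j"
    proof (rule bob_protocol_probability[OF orthonormal_pair_family[OF on ij'] w t(1)])
      fix q l :: nat assume ql: "q < 2" "l < dB"
      \<comment> \<open>Contraction with the conjugate of \<open>e k\<close> extracts
        \<open>c k * f k\<close>, so the division by \<open>c k\<close> in the filter cancels the
        Schmidt coefficient.\<close>
      have red: "(\<Sum>a<dA. complex_of_real (sqrt (t i j)) * (cnj (e k $ a) / c k) * v $ (a * dB + l))
          = complex_of_real (sqrt (t i j)) * f k $ l" if "k < r" for k
      proof -
        have "(\<Sum>a<dA. complex_of_real (sqrt (t i j)) * (cnj (e k $ a) / c k) * v $ (a * dB + l))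
            = complex_of_real (sqrt (t i j)) / c k * (\<Sum>a<dA. cnj (e k $ a) * v $ (a * dB + l))"
          by (simp add: sum_distrib_left mult.assoc)
        thus ?thesis using c[OF that] by (simp add: schmidt_decomposition_apply(2)[OF S that ql(2)])
      qed
      have "(?T ?K *\<^sub>v v) $ (q * dB + l) = (\<Sum>a<dA. complex_of_real (sqrt (t i j)) *
          (cnj (e (if q = 0 then i else j) $ a) / c (if q = 0 then i else j)) * v $ (a * dB + l))"
        unfolding index_tensor_left[OF K v ql] using ql
        by (intro sum.cong refl) (simp add: alice_filter_def)
      also have "\<dots> = complex_of_real (sqrt (t i j)) * f (if q = 0 then i else j) $ l"
        using ij' by (intro red) auto
      finally show "(?T ?K *\<^sub>v v) $ (q * dB + l) = complex_of_real (sqrt (t i j)) * ?g q $ l"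
        by (simp add: pair_family_def)
    qed
    thus ?thesis using op by simp
  qed
  have fail: "final_bell_probability (?out ?fail) = 0"
    by (simp add: final_bell_probability_def)
  have "outcomes dA dB (projector v) (bell_protocol dA dB r c e f t)
      = concat (map ?out (map ?succ (index_pairs r))) @ ?out ?fail"
    unfolding bell_protocol_def by simp
  hence "bell_probability dA dB v (bell_protocol dA dB r c e f t)
      = final_bell_probability (concat (map ?out (map ?succ (index_pairs r)))) + final_bell_probability (?out ?fail)"
    by (simp add: bell_probability_def final_bell_probability_def)
  also have "final_bell_probability (concat (map ?out (map ?succ (index_pairs r))))
      = (\<Sum>p\<leftarrow>index_pairs r. final_bell_probability (?out (?succ p)))"
    by (simp only: final_bell_probability_concat map_map o_def)
  also have "\<dots> = (\<Sum>(i, j)\<leftarrow>index_pairs r. 2 * t i j)"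
    using succ
    by (auto intro!: arg_cong[where f = sum_list] map_cong)
  also have "\<dots> = (\<Sum>i<r. \<Sum>j<r. 2 * t i j)"
    by (rule sum_index_pairs) (simp add: t(2))
  finally show ?thesis using fail by simp
qed


section \<open>The transfer state and the theorem\<close>

lemma norm_sq_transfer_state:
  assumes \<Omega>: "\<Omega> \<in> carrier_vec (a * b * k)"
  shows "norm_sq (transfer_state \<theta> a b k \<Omega>) = norm_sq \<Omega>"
proof -
  define n where "n = a * b * k"
  define \<psi> where "\<psi> = psi_state \<theta>"
  have dim: "dim_vec \<Omega> = n" using \<Omega> by (simp add: n_def)
  have d4: "dim_vec \<psi> = 4" by (simp add: \<psi>_def psi_state_def)
  \<comment> \<open>\<open>p, q\<close> are the basis labels of A, B, and \<open>x, y, z\<close>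
    those of A', B', K. Rearranging the registers only permutes the amplitudes of the product, so
    the squared norm factorises.\<close>
  have idx: "transfer_state \<theta> a b k \<Omega> $ ((p * (a * k) + (x * k + z)) * (2 * b) + (q * b + y))
      = \<psi> $ (p * 2 + q) * \<Omega> $ ((x * b + y) * k + z)"
    if "p < 2" "x < a" "z < k" "q < 2" "y < b" for p x z q y
  proof -
    define A where "A = p * (a * k) + (x * k + z)"
    define B where "B = q * b + y"
    have xz: "x * k + z < a * k" using that by (intro prod_index_less)
    have A: "A < 2 * (a * k)" unfolding A_def using that xz by (intro prod_index_less)
    have B: "B < 2 * b" unfolding B_def using that by (intro prod_index_less)
    have AB: "A * (2 * b) + B < (2 * a * k) * (2 * b)"
      using prod_index_less[OF A B] by (simp add: mult.assoc)
    have 1: "(A * (2 * b) + B) div (2 * b) = A" "(A * (2 * b) + B) mod (2 * b) = B"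
      using B by (simp_all add: div_mult_self3)
    have "A div (a * k) = p + (x * k + z) div (a * k)"
      unfolding A_def using that by (intro div_mult_self3) auto
    hence 2: "A div (a * k) = p" using xz by simp
    have "A = (p * a + x) * k + z" by (simp add: A_def algebra_simps)
    hence 3: "A div k = p * a + x" "A mod k = z" using that by simp_all
    have 4: "A div k mod a = x" unfolding 3 using that by simp
    have 5: "B div b = q" "B mod b = y" using that by (simp_all add: B_def)
    have y: "(x * b + y) * k + z < n"
      unfolding n_def using that by (intro prod_index_less)
    have "p * 2 + q < 4" using prod_index_less[of p 2 q 2] that by simp
    have 6: "(p * 2 + q) * n + ((x * b + y) * k + z) < 4 * n"
      by (rule prod_index_less) fact+
    have "transfer_state \<theta> a b k \<Omega> $ (A * (2 * b) + B)
        = tensor_vec \<psi> \<Omega> $ ((p * 2 + q) * n + ((x * b + y) * k + z))"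
      using AB unfolding transfer_state_def
      by (simp only: index_vec Let_def 1 2 3(2) 4 5 n_def \<psi>_def)
    also have "\<dots> = \<psi> $ (p * 2 + q) * \<Omega> $ ((x * b + y) * k + z)"
      using 6 y by (simp add: tensor_vec_def d4 dim)
    finally show ?thesis by (simp only: A_def B_def)
  qed
  have c: "transfer_state \<theta> a b k \<Omega> \<in> carrier_vec ((2 * (a * k)) * (2 * b))"
    by (simp add: transfer_state_def mult.assoc)
  define f where "f = (\<lambda>p q. (cmod (\<psi> $ (p * 2 + q)))\<^sup>2)"
  define g where "g = (\<lambda>x y z. (cmod (\<Omega> $ ((x * b + y) * k + z)))\<^sup>2)"
  have "norm_sq (transfer_state \<theta> a b k \<Omega>)
      = (\<Sum>p<2. \<Sum>x<a. \<Sum>z<k. \<Sum>q<2. \<Sum>y<b. f p q * g x y z)"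
    unfolding norm_sq_bipartite[OF c] sum_lessThan_mult f_def g_def
    by (intro sum.cong refl) (simp add: idx norm_mult power_mult_distrib)
  also have "\<dots> = (\<Sum>p<2. \<Sum>q<2. f p q * (\<Sum>x<a. \<Sum>z<k. \<Sum>y<b. g x y z))"
    by (simp add: sum_two sum.distrib sum_distrib_left distrib_right)
  also have "(\<Sum>x<a. \<Sum>z<k. \<Sum>y<b. g x y z) = norm_sq \<Omega>"
  proof -
    have "(\<Sum>x<a. \<Sum>z<k. \<Sum>y<b. g x y z) = (\<Sum>x<a. \<Sum>y<b. \<Sum>z<k. g x y z)"
      by (intro sum.cong refl sum.swap)
    also have "\<dots> = (\<Sum>i<a * b. \<Sum>z<k. (cmod (\<Omega> $ (i * k + z)))\<^sup>2)"
      unfolding sum_lessThan_mult[of _ a b] g_def ..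
    finally show ?thesis unfolding norm_sq_bipartite[OF \<Omega>] .
  qed
  also have "(\<Sum>p<2. \<Sum>q<2. f p q * norm_sq \<Omega>) = norm_sq \<Omega>"
  proof -
    have "f 0 0 = (cos \<theta>)\<^sup>2" "f 0 1 = 0" "f 1 0 = 0" "f 1 1 = (sin \<theta>)\<^sup>2"
      by (simp_all add: f_def \<psi>_def psi_state_def vec_of_list_index numeral_2_eq_2 numeral_3_eq_3)
    thus ?thesis by (simp add: sum_two distrib_right[symmetric])
  qed
  finally show ?thesis .
qed

lemma pure_state_norm_sq: "pure_state n v \<Longrightarrow> norm_sq v = 1"
proof -
  assume p: "pure_state n v"
  hence "v \<bullet>c v = (\<Sum>i<dim_vec v. v $ i * cnj (v $ i))"
    by (simp add: scalar_prod_def atLeast0LessThan)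
  also have "\<dots> = complex_of_real (norm_sq v)"
    by (simp only: norm_sq_def of_real_sum complex_norm_square)
  finally show "norm_sq v = 1" using p by (simp add: pure_state_def)
qed

lemma optimal_bell_probability_pure_state:
  assumes v: "v \<in> carrier_vec (dA * dB)" and norm: "norm_sq v = 1"
  shows "optimal_bell_probability dA dB v (min 1 (2 * (1 - lambda_max dA dB v)))"
  unfolding optimal_bell_probability_def
proof (intro conjI allI impI)
  let ?p = "min 1 (2 * (1 - lambda_max dA dB v))"
  show upper: "bell_probability dA dB v P \<le> ?p" if P: "locc_protocol dA dB P" for P
  proof -
    obtain x where x: "(\<Sum>j<dB. (cmod (x j))\<^sup>2) \<le> 1" "overlap dA dB v x = lambda_max dA dB v"
      using lambda_max_overlap[OF v norm] .
    show ?thesis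
      using bell_probability_le(1)[OF P v norm] bell_probability_le(2)[OF P v norm x(1)] x(2) by simp
  qed
  obtain r c e f where S: "schmidt_decomposition dA dB v r c e f"
    using schmidt_decomposition_exists[OF v] .
  have sum: "(\<Sum>i<r. (c i)\<^sup>2) = 1" using schmidt_coefficients_sum_squares[OF S] norm by simp
  hence "{..<r} \<noteq> {}" by (cases "r = 0") auto
  then obtain i0 where i0: "i0 < r" "\<And>i. i < r \<Longrightarrow> (c i)\<^sup>2 \<le> (c i0)\<^sup>2"
    using obtains_MAX[of "{..<r}" "\<lambda>i. (c i)\<^sup>2"] by (metis Max_ge finite_imageI finite_lessThan image_eqI lessThan_iff)
  show "\<exists>P. locc_protocol dA dB P \<and> bell_probability dA dB v P = ?p"
  proof (rule bell_weights_exist[of r "\<lambda>i. (c i)\<^sup>2", OF zero_le_power2 sum i0])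
    fix t :: "nat \<Rightarrow> nat \<Rightarrow> real"
    assume t: "\<And>i j. 0 \<le> t i j" "\<And>i. i < r \<Longrightarrow> t i i = 0"
      "\<And>i. i < r \<Longrightarrow> (\<Sum>j<r. t i j + t j i) \<le> (c i)\<^sup>2"
      and total: "(\<Sum>i<r. \<Sum>j<r. 2 * t i j) = min 1 (2 * (1 - (c i0)\<^sup>2))"
    let ?P = "bell_protocol dA dB r c e f t"
    have valid: "locc_protocol dA dB ?P" by (rule bell_protocol_valid[OF S, of t, OF t])
    have "bell_probability dA dB v ?P = min 1 (2 * (1 - (c i0)\<^sup>2))"
      using bell_protocol_probability[OF S, of t, OF t(1,2)] total by simp
    \<comment> \<open>\<open>c i0\<close> is the largest coefficient of one decomposition, while
      \<open>lambda_max\<close> refers to all of them. The inequality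
      \<open>(c i0)\<^sup>2 \<le> lambda_max dA dB v\<close> makes the protocol at least as good as
      claimed, and the upper bound then forces equality.\<close>
    also have "\<dots> \<ge> ?p" using schmidt_coefficient_le_lambda_max[OF S i0(1)] by auto
    finally show ?thesis using upper[OF valid] valid by (intro exI[of _ ?P] conjI antisym)
  qed
qed

theorem mainTheorem9:
  fixes \<theta> :: real and a b k :: nat and \<Omega> :: "complex vec"
  assumes "0 < \<theta>" and "\<theta> < pi / 2"
    and "pure_state (a * b * k) \<Omega>"
  shows "optimal_bell_probability (2 * a * k) (2 * b) (transfer_state \<theta> a b k \<Omega>)
           (min 1 (2 * (1 - lambda_max (2 * a * k) (2 * b) (transfer_state \<theta> a b k \<Omega>))))"
proof (rule optimal_bell_probability_pure_state)
  show "transfer_state \<theta> a b k \<Omega> \<in> carrier_vec (2 * a * k * (2 * b))"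
    by (simp add: transfer_state_def)
  show "norm_sq (transfer_state \<theta> a b k \<Omega>) = 1"
    using norm_sq_transfer_state pure_state_norm_sq assms(3) by (auto simp: pure_state_def)
qed

end
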